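(* Let $\ell\ge1$, let $\Phi$ be a root system of type $A_\ell$, let $j\in\{0,1,\dots,\ell\}$, $\omega := \omega_j\in W_{A_\circ}$, $g := \gcd\{\ell+1,j\}$ and $d := o(\omega)$ the order of $\omega$. Then for every $q\in\mathbb{Z}_{>0}$, $$\chi_{\Phi,q}(\omega) = \begin{cases} 0 & \text{if } q\notin d\mathbb{Z},\\ \varphi(d)(q-d)(q-2d)\cdots(q-d(g-1)) & \text{if } q\in d\mathbb{Z},\end{cases}$$ where $\varphi$ is Euler's totient function.
   Context: Let $\Phi = \{\pm(e_i-e_k) : 1\le i<k\le\ell+1\}$ in $E = \{x\in\mathbb{R}^{\ell+1} : \sum x_i=0\}$, with simple roots $\alpha_i = e_i-e_{i+1}$ ($1\le i\le\ell$), Weyl group $W$ and the standard inner product $(\cdot,\cdot)$. The coweight lattice is $Z := \{x\in E : (\alpha,x)\in\mathbb{Z}\ \forall\alpha\in\Phi\}$. For $q\in\mathbb{Z}_{>0}$, $M(\Phi;q) := \{x+qZ\in Z/qZ : (\beta,x)\not\equiv0\pmod q\ \forall\beta\in\Phi\}$; $W$ acts on it via $w(x+qZ)=w(x)+qZ$, and $\chi_{\Phi,q}(w) := \#\{t\in M(\Phi;q) : w(t)=t\}$. Let $\tilde\alpha=\sum_{i=1}^\ell n_i\alpha_i$ be the highest root, $n_0:=1$, $J:=\{i\in\{0,\dots,\ell\}: n_i=1\}$ (here $J=\{0,\dots,\ell\}$). Let $w_0$ be the longest element of $W$; for $j\in J\setminus\{0\}$ let $w_j$ be the longest element of the subgroup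 generated by the simple reflections $s_{\alpha_i}$, $i\ne j$; put $\omega_j := w_jw_0$ and $\omega_0:=1$. Let $A_\circ=\{x\in E : (\alpha_i,x)>0\ \forall i,\ (\tilde\alpha,x)<1\}$; $W_{A_\circ}$ is the subgroup of $w\in W$ mapping the image of $A_\circ$ in $E/Z$ to itself, and $W_{A_\circ}=\{\omega_j : j\in J\}$. Convention: $\gcd\{\ell+1,0\}=\ell+1$; an empty product is $1$. *)

theory Defs
  imports
    Complex_Main
    "HOL-Library.Real_Mod"
    "HOL-Number_Theory.Totient"
    "HOL-Algebra.Bij"
    "HOL-Algebra.Generated_Groups"
    "HOL-Algebra.Multiplicative_Group"
begin

section \<open>The root system of type A\<close>

text \<open>Vectors of real (l+1)-space are functions \<^typ>\<open>nat \<Rightarrow> real\<close> that vanish outside the index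
  set {1..l+1}, so that l is an ordinary variable.\<close>

definition euclid :: "nat \<Rightarrow> (nat \<Rightarrow> real) set" where
  "euclid l = {x. (\<forall>i. i \<notin> {1..l+1} \<longrightarrow> x i = 0) \<and> (\<Sum>i=1..l+1. x i) = 0}"

definition ip :: "nat \<Rightarrow> (nat \<Rightarrow> real) \<Rightarrow> (nat \<Rightarrow> real) \<Rightarrow> real" where
  "ip l x y = (\<Sum>i=1..l+1. x i * y i)"

definition unit_vec :: "nat \<Rightarrow> nat \<Rightarrow> real" where
  "unit_vec i = (\<lambda>k. if k = i then 1 else 0)"

definition roots :: "nat \<Rightarrow> (nat \<Rightarrow> real) set" where
  "roots l = {unit_vec i - unit_vec k | i k. 1 \<le> i \<and> i < k \<and> k \<le> l+1} \<union>
             {- (unit_vec i - unit_vec k) | i k. 1 \<le> i \<and> i < k \<and> k \<le> l+1}"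

definition simple_root :: "nat \<Rightarrow> nat \<Rightarrow> real" where
  "simple_root i = unit_vec i - unit_vec (i+1)"


section \<open>The Weyl group and longest elements\<close>

text \<open>Elements of \<^term>\<open>BijGroup S\<close> are extensional functions, hence the restriction to
  \<^term>\<open>euclid l\<close>; the group multiplication is composition, applying the right factor first.\<close>

definition reflection :: "nat \<Rightarrow> (nat \<Rightarrow> real) \<Rightarrow> (nat \<Rightarrow> real) \<Rightarrow> (nat \<Rightarrow> real)" where
  "reflection l \<alpha> = (\<lambda>x \<in> euclid l. (\<lambda>k. x k - 2 * ip l \<alpha> x / ip l \<alpha> \<alpha> * \<alpha> k))"

definition weyl_group :: "nat \<Rightarrow> ((nat \<Rightarrow> real) \<Rightarrow> (nat \<Rightarrow> real)) monoid" where
  "weyl_group l = subgroup_generated (BijGroup (euclid l)) (reflection l ` roots l)"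

definition word_length :: "('a, 'b) monoid_scheme \<Rightarrow> 'a set \<Rightarrow> 'a \<Rightarrow> nat" where
  "word_length G S w =
     (LEAST n. \<exists>ss. set ss \<subseteq> S \<and> length ss = n \<and> foldr (mult G) ss (one G) = w)"

text \<open>The longest element of the group generated by S, for a set S of involutions such as the
  simple reflections of a finite Coxeter group (there it exists and is unique).\<close>

definition longest_element :: "('a, 'b) monoid_scheme \<Rightarrow> 'a set \<Rightarrow> 'a" where
  "longest_element G S = (THE w. is_arg_max (word_length G S) (\<lambda>v. v \<in> generate G S) w)"

definition simple_reflections :: "nat \<Rightarrow> nat set \<Rightarrow> ((nat \<Rightarrow> real) \<Rightarrow> (nat \<Rightarrow> real)) set" where
  "simple_reflections l I = (\<lambda>i. reflection l (simple_root i)) ` I"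

text \<open>The element omega_j = w_j w_0 for j > 0, and omega_0 = 1. All coefficients of the highest
  root of type A are 1, so every j in {0..l} is admissible.\<close>

definition omega :: "nat \<Rightarrow> nat \<Rightarrow> (nat \<Rightarrow> real) \<Rightarrow> (nat \<Rightarrow> real)" where
  "omega l j =
     (if j = 0 then \<one>\<^bsub>weyl_group l\<^esub>
      else longest_element (weyl_group l) (simple_reflections l ({1..l} - {j}))
             \<otimes>\<^bsub>weyl_group l\<^esub>
           longest_element (weyl_group l) (simple_reflections l {1..l}))"


section \<open>The coweight lattice and the action on the complement modulo q\<close>

definition coweight_lattice :: "nat \<Rightarrow> (nat \<Rightarrow> real) set" where
  "coweight_lattice l = {x \<in> euclid l. \<forall>\<alpha>\<in>roots l. ip l \<alpha> x \<in> \<int>}"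

definition lattice_coset :: "nat \<Rightarrow> nat \<Rightarrow> (nat \<Rightarrow> real) \<Rightarrow> (nat \<Rightarrow> real) set" where
  "lattice_coset l q x = {(\<lambda>k. x k + real q * z k) | z. z \<in> coweight_lattice l}"

text \<open>The condition on x depends only on the coset of x.\<close>

definition complement_mod :: "nat \<Rightarrow> nat \<Rightarrow> (nat \<Rightarrow> real) set set" where
  "complement_mod l q =
     {lattice_coset l q x | x. x \<in> coweight_lattice l \<and>
        (\<forall>\<beta>\<in>roots l. \<not> [ip l \<beta> x = 0] (rmod real q))}"

text \<open>As w is linear and preserves the coweight lattice Z, the image of x + qZ under w, as a set
  of vectors, is w(x) + qZ.\<close>

definition chi :: "nat \<Rightarrow> nat \<Rightarrow> ((nat \<Rightarrow> real) \<Rightarrow> (nat \<Rightarrow> real)) \<Rightarrow> nat" where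
  "chi l q w = card {t \<in> complement_mod l q. w ` t = t}"

end

theory Submission
  imports Defs "HOL-Combinatorics.Permutations"
begin

text \<open>Write n = l + 1. The Weyl group acts by permuting coordinates, and the length of a permutation
  in the adjacent transpositions is its number of inversions. Hence the longest elements w_0 and
  w_j are the reversal of {1..n} and the simultaneous reversal of the blocks {1..j} and {j+1..n},
  and omega_j is a cyclic shift of the coordinates (\<open>omega_eq\<close>). Its order is
  d = n / gcd n j (\<open>ord_cyclic_shift\<close>).

  A point of the coweight lattice is determined by its coordinate differences, which are integers.
  Subtracting the first coordinate and reducing modulo q therefore identifies the points of the
  complement modulo q with the injective labelings f of {0..<n} by residues modulo q
  with f 0 = 0 (\<open>bij_betw_labelings_complement\<close>). A point is fixed by the cyclic shift through
  s = n - j places iff shifting adds a constant c to the labeling, that is, f (i + s) = f i + c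
  modulo n and q respectively (\<open>fixed_coset_iff_equivariant\<close>).

  Such a labeling is determined by c and its values at 0, ..., g-1, where g = gcd n s = gcd n j,
  because these are representatives of the g orbits of the shift, each of size d.
  Going once around an orbit adds d c, and by injectivity no shorter multiple of c vanishes, so c
  has order exactly d in the integers modulo q. This forces d to divide q and leaves totient d
  choices for c. The multiples of c are the multiples of m = q / d, so injectivity of f says that
  the g representatives are labeled by distinct residues modulo m. With the first label 0, the
  label number k (counted from 0) avoids k residue classes of d elements each,
  which leaves q - d k choices. The product over k is the stated formula (\<open>card_equivariant\<close>).\<close>

section \<open>Multiples modulo n\<close>

text \<open>The order of j in the integers modulo n is n / gcd n j.\<close>

lemma cong_mult_iff_div_gcd:
  fixes n j k k' :: nat
  assumes "n > 0"
  shows "[k * j = k' * j] (mod n) \<longleftrightarrow> [k = k'] (mod n div gcd n j)"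
proof -
  define g where "g = gcd n j"
  have g: "g > 0" using assms by (simp add: g_def)
  obtain a b where ab: "n = a * g" "j = b * g" "coprime a b"
    using gcd_coprime_exists[of n j] g unfolding g_def by auto
  have dvd: "n dvd k * j \<longleftrightarrow> a dvd k" for k
  proof -
    have "n dvd k * j \<longleftrightarrow> a dvd k * b" using g by (simp add: ab(1,2) mult.assoc[symmetric])
    then show ?thesis using ab(3) by (simp add: coprime_dvd_mult_left_iff)
  qed
  have a: "n div gcd n j = a" using ab(1) g unfolding g_def[symmetric] by simp
  show ?thesis
  proof (induction k k' rule: linorder_wlog)
    case (le k k')
    have "[k' * j = k * j] (mod n) \<longleftrightarrow> n dvd (k' - k) * j"
      using le by (subst cong_altdef_nat) (auto simp: diff_mult_distrib)
    also have "\<dots> \<longleftrightarrow> [k' = k] (mod a)"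
      unfolding dvd using le by (simp add: cong_altdef_nat)
    finally show ?case unfolding a by (simp add: cong_sym_eq)
  qed (simp add: cong_sym_eq)
qed

lemma dvd_mult_iff_div_gcd:
  fixes n j k :: nat
  assumes "n > 0"
  shows "n dvd k * j \<longleftrightarrow> n div gcd n j dvd k"
  using cong_mult_iff_div_gcd[OF assms, of k j 0] by (simp add: cong_0_iff)

section \<open>Inversions and block-preserving permutations\<close>

definition inversions :: "nat \<Rightarrow> (nat \<Rightarrow> nat) \<Rightarrow> (nat \<times> nat) set" where
  "inversions n p = {(a, b). 1 \<le> a \<and> a < b \<and> b \<le> n \<and> p b < p a}"

text \<open>The parabolic subgroup generated by the adjacent transpositions except the one exchanging j and
  j + 1. Taking j = 0 gives all permutations of {1..n}, so that w_0 and w_j need no separate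
  treatment.\<close>

definition block_perms :: "nat \<Rightarrow> nat \<Rightarrow> (nat \<Rightarrow> nat) set" where
  "block_perms n j = {p. p permutes {1..n} \<and> p ` {1..j} = {1..j}}"

text \<open>The block {1..j} and its complement are both reversed; for j = 0 this is the reversal of {1..n}.\<close>

definition reversal :: "nat \<Rightarrow> nat \<Rightarrow> nat \<Rightarrow> nat" where
  "reversal n j a =
     (if 1 \<le> a \<and> a \<le> j then j + 1 - a else if j < a \<and> a \<le> n then n + j + 1 - a else a)"

abbreviation adj :: "nat \<Rightarrow> nat \<Rightarrow> nat" where
  "adj i \<equiv> transpose i (Suc i)"

lemma finite_inversions: "finite (inversions n p)"
  by (rule finite_subset[of _ "{1..n} \<times> {1..n}"]) (auto simp: inversions_def)

text \<open>The inversions determine the relative order of all the values of p, hence the rank of every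
  value.\<close>

lemma inversions_determine_perm:
  assumes p: "p permutes {1..n}" and r: "r permutes {1..n}"
    and eq: "inversions n p = inversions n r"
  shows "p = r"
proof
  have less_iff: "p b < p a \<longleftrightarrow> r b < r a" if "a \<in> {1..n}" "b \<in> {1..n}" for a b
  proof -
    have inj: "inj p" "inj r"
      using p r permutes_inj by blast+
    consider "a < b" | "a = b" | "b < a" by linarith
    then show ?thesis
    proof cases
      case 1
      then have "(a, b) \<in> inversions n p \<longleftrightarrow> (a, b) \<in> inversions n r" using eq by simp
      with 1 that show ?thesis by (auto simp: inversions_def)
    next
      case 3
      then have "(b, a) \<in> inversions n p \<longleftrightarrow> (b, a) \<in> inversions n r" using eq by simp
      with 3 that have "p a < p b \<longleftrightarrow> r a < r b" by (auto simp: inversions_def)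
      moreover have "p a \<noteq> p b" "r a \<noteq> r b" using 3 inj by (auto dest: injD)
      ultimately show ?thesis by linarith
    qed auto
  qed
  \<comment> \<open>The values fill {1..n}, so each of them is determined by the number of smaller ones.\<close>
  have rank: "s a = Suc (card {b \<in> {1..n}. s b < s a})"
    if s: "s permutes {1..n}" and a: "a \<in> {1..n}" for s a
  proof -
    have "s ` {b \<in> {1..n}. s b < s a} = {c \<in> s ` {1..n}. c < s a}" by auto
    also have "\<dots> = {1..<s a}"
      using permutes_image[OF s] permutes_in_image[OF s, of a] a by auto
    finally have "card (s ` {b \<in> {1..n}. s b < s a}) = s a - 1" by simp
    moreover have "card (s ` {b \<in> {1..n}. s b < s a}) = card {b \<in> {1..n}. s b < s a}"
      using permutes_inj[OF s] by (intro card_image) (auto dest: injD intro: inj_onI)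
    moreover have "s a \<ge> 1" using permutes_in_image[OF s, of a] a by auto
    ultimately show ?thesis by simp
  qed
  show "p a = r a" for a
  proof (cases "a \<in> {1..n}")
    case True
    have "{b \<in> {1..n}. p b < p a} = {b \<in> {1..n}. r b < r a}" using less_iff[OF True] by auto
    with rank[OF p True] rank[OF r True] show ?thesis by metis
  next
    case False
    then show ?thesis using p r by (simp add: permutes_def)
  qed
qed

lemma adj_permutes:
  assumes "1 \<le> i" "i < n"
  shows "adj i permutes {1..n}"
  using assms by (intro permutes_swap_id) auto

text \<open>Applying the transposition to both positions of a pair matches the inversions before and after, apart
  from the pair at the positions i and i + 1 itself.\<close>

lemma card_inversions_descent:
  assumes i: "1 \<le> i" "i < n" and less: "p (Suc i) < p i"
  shows "card (inversions n p) = Suc (card (inversions n (p \<circ> adj i)))"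
proof -
  let ?f = "map_prod (adj i) (adj i)"
  have mono: "adj i a < adj i b" if "a < b" "(a, b) \<noteq> (i, Suc i)" for a b
    using that by (auto simp: transpose_def)
  have range: "adj i a \<in> {1..n} \<longleftrightarrow> a \<in> {1..n}" for a
    using permutes_in_image[OF adj_permutes[OF i]] .
  have inv_iff: "(a, b) \<in> inversions n r \<longleftrightarrow> a \<in> {1..n} \<and> b \<in> {1..n} \<and> a < b \<and> r b < r a" for a b r
    unfolding inversions_def by auto
  have "bij_betw ?f (inversions n p - {(i, Suc i)}) (inversions n (p \<circ> adj i))"
  proof (rule bij_betwI[where g = ?f])
    show "?f \<in> inversions n p - {(i, Suc i)} \<rightarrow> inversions n (p \<circ> adj i)"
    proof (intro funcsetI, unfold split_paired_all)
      fix a b assume ab: "(a, b) \<in> inversions n p - {(i, Suc i)}"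
      then have "adj i a < adj i b" using mono inv_iff by blast
      then show "?f (a, b) \<in> inversions n (p \<circ> adj i)"
        using ab unfolding map_prod_simp inv_iff range by (simp add: inv_iff)
    qed
    show "?f \<in> inversions n (p \<circ> adj i) \<rightarrow> inversions n p - {(i, Suc i)}"
    proof (intro funcsetI, unfold split_paired_all)
      fix a b assume ab: "(a, b) \<in> inversions n (p \<circ> adj i)"
      \<comment> \<open>After exchanging the two entries the pair at positions i, i + 1 is in order.\<close>
      then have "(a, b) \<noteq> (i, Suc i)" using less by (auto simp: inv_iff)
      then have "adj i a < adj i b" using ab mono inv_iff by blast
      moreover have "adj i a \<noteq> i \<or> adj i b \<noteq> Suc i"
        using ab unfolding inv_iff transpose_def by (auto split: if_splits)
      ultimately show "?f (a, b) \<in> inversions n p - {(i, Suc i)}"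
        using ab unfolding map_prod_simp inv_iff Diff_iff range by (simp add: inv_iff)
    qed
  qed (simp_all add: split_paired_all)
  then have "card (inversions n p - {(i, Suc i)}) = card (inversions n (p \<circ> adj i))"
    by (rule bij_betw_same_card)
  moreover have "(i, Suc i) \<in> inversions n p" using i less by (auto simp: inversions_def)
  ultimately show ?thesis
    using finite_inversions[of n p] by (metis card_Suc_Diff1)
qed

lemma card_inversions_adj_le:
  assumes p: "p permutes {1..n}" and i: "1 \<le> i" "i < n"
  shows "card (inversions n (p \<circ> adj i)) \<le> Suc (card (inversions n p))"
proof (cases "p (Suc i) < p i")
  case True
  then show ?thesis using card_inversions_descent[OF i] by simp
next
  case False
  moreover have "p i \<noteq> p (Suc i)" using inj_eq[OF permutes_inj[OF p], of i "Suc i"] by simp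
  ultimately have "(p \<circ> adj i) (Suc i) < (p \<circ> adj i) i" by simp
  from card_inversions_descent[OF i this] show ?thesis by (simp only: comp_assoc transpose_comp_involutory comp_id)
qed

lemma block_perms_image_iff:
  assumes "p \<in> block_perms n j" 
  shows "p a \<in> {1..j} \<longleftrightarrow> a \<in> {1..j}"
proof -
  have "inj p" "p ` {1..j} = {1..j}"
    using assms permutes_inj by (auto simp: block_perms_def)
  from inj_image_mem_iff[OF this(1), of a "{1..j}"] this(2) show ?thesis by simp
qed

lemma block_perms_permutes: "p \<in> block_perms n j \<Longrightarrow> p permutes {1..n}"
  by (simp add: block_perms_def)

lemma id_in_block_perms: "id \<in> block_perms n j"
  by (simp add: block_perms_def permutes_id)

lemma comp_in_block_perms:
  "p \<in> block_perms n j \<Longrightarrow> r \<in> block_perms n j \<Longrightarrow> p \<circ> r \<in> block_perms n j"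
  by (simp only: block_perms_def mem_Collect_eq permutes_compose image_comp[symmetric])

lemma adj_in_block_perms:
  assumes "i \<in> {1..<n} - {j}"
  shows "adj i \<in> block_perms n j"
proof -
  have "adj i ` {1..j} = {1..j}"
  proof (cases "i < j")
    case True
    then show ?thesis using assms by (intro permutes_image permutes_swap_id) auto
  next
    case False
    then have "adj i a = a" if "a \<in> {1..j}" for a using that assms by (auto simp: transpose_def)
    then have "adj i ` {1..j} = (\<lambda>a. a) ` {1..j}" by (intro image_cong refl) 
    then show ?thesis by simp
  qed
  then show ?thesis using assms adj_permutes[of i n] by (simp add: block_perms_def)
qed

text \<open>A position other than j with a descent exists because there is never a descent at j: the block
  {1..j} is preserved, so the value at j is at most j and the value at j + 1 exceeds j.\<close>

lemma block_perms_descent: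
  assumes p: "p \<in> block_perms n j" and "p \<noteq> id"
  obtains i where "i \<in> {1..<n} - {j}" "p (Suc i) < p i"
proof -
  have "\<exists>i \<in> {1..<n} - {j}. p (Suc i) < p i"
  proof (rule ccontr)
    assume no: "\<not> ?thesis"
    have perm: "p permutes {1..n}" using p by (rule block_perms_permutes)
    have step: "p i < p (Suc i)" if i: "1 \<le> i" "i < n" for i
    proof (cases "i = j")
      case True
      then have "p i \<in> {1..j}" "p (Suc i) \<notin> {1..j}"
        using block_perms_image_iff[OF p] i by auto
      moreover have "p (Suc i) \<in> {1..n}" using permutes_in_image[OF perm] i by auto
      ultimately show ?thesis by auto
    next
      case False
      then have "p i \<le> p (Suc i)" using no i by force
      moreover have "p i \<noteq> p (Suc i)" using inj_eq[OF permutes_inj[OF perm], of i "Suc i"] by simp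
      ultimately show ?thesis by simp
    qed
    have mono: "p a < p b" if "1 \<le> a" "a < b" "b \<le> n" for a b
      using that(2,1,3)
    proof (induction rule: strict_inc_induct)
      case (base c)
      then show ?case using step[of c] by auto
    next
      case (step c)
      then show ?case using \<open>\<And>i. 1 \<le> i \<Longrightarrow> i < n \<Longrightarrow> p i < p (Suc i)\<close>[of c] by force
    qed
    then have "inversions n p = {}" by (fastforce simp: inversions_def)
    moreover have "inversions n id = {}" by (auto simp: inversions_def)
    ultimately show False
      using inversions_determine_perm[OF perm permutes_id] \<open>p \<noteq> id\<close> by metis
  qed
  with that show thesis by blast
qed


lemma reversal_involution:
  assumes "j \<le> n"
  shows "reversal n j (reversal n j a) = a"
  using assms by (auto simp: reversal_def)

lemma reversal_in_block_perms:
  assumes "j \<le> n"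
  shows "reversal n j \<in> block_perms n j"
proof -
  have stable: "reversal n j ` S = S" if "\<And>a. a \<in> S \<Longrightarrow> reversal n j a \<in> S" for S
    using that reversal_involution[OF assms] by (metis (no_types, lifting) image_iff subsetI subset_antisym)
  have "inj_on (reversal n j) {1..n}"
    using reversal_involution[OF assms] by (metis inj_onI)
  moreover have "reversal n j ` {1..n} = {1..n}"
    using assms by (intro stable) (auto simp: reversal_def)
  ultimately have "reversal n j permutes {1..n}"
    using assms by (intro bij_imp_permutes) (auto simp: bij_betw_def reversal_def)
  moreover have "reversal n j ` {1..j} = {1..j}"
    using assms by (intro stable) (auto simp: reversal_def)
  ultimately show ?thesis by (simp add: block_perms_def)
qed

text \<open>Two positions in different blocks are never inverted by a block-preserving permutation, and
  the reversal inverts all other pairs.\<close>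

lemma inversions_subset_reversal:
  assumes p: "p \<in> block_perms n j" and "j \<le> n"
  shows "inversions n p \<subseteq> inversions n (reversal n j)"
proof (clarify)
  fix a b assume ab: "(a, b) \<in> inversions n p"
  have "\<not> (a \<le> j \<and> j < b)"
  proof
    assume c: "a \<le> j \<and> j < b"
    with ab have "p a \<in> {1..j}" "p b \<notin> {1..j}"
      using block_perms_image_iff[OF p] by (auto simp: inversions_def)
    moreover have "p b \<in> {1..n}"
      using permutes_in_image[OF block_perms_permutes[OF p]] ab by (auto simp: inversions_def)
    ultimately show False using ab by (auto simp: inversions_def)
  qed
  with ab \<open>j \<le> n\<close> show "(a, b) \<in> inversions n (reversal n j)"
    by (auto simp: inversions_def reversal_def)
qed

text \<open>The number of inversions is maximal only if the inclusion of inversion sets is an equality, and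
  the inversion set determines the permutation. This gives the uniqueness of the longest element.\<close>

lemma card_inversions_max_iff:
  assumes p: "p \<in> block_perms n j" and "j \<le> n"
    and le: "card (inversions n (reversal n j)) \<le> card (inversions n p)"
  shows "p = reversal n j"
proof (rule inversions_determine_perm)
  show "p permutes {1..n}" "reversal n j permutes {1..n}"
    using p reversal_in_block_perms[OF \<open>j \<le> n\<close>] by (simp_all add: block_perms_def)
  show "inversions n p = inversions n (reversal n j)"
    using inversions_subset_reversal[OF p \<open>j \<le> n\<close>] le by (intro card_seteq finite_inversions)
qed

text \<open>The positions start at 1, whence the shift by one around the reduction modulo n.\<close>

definition cyclic_shift :: "nat \<Rightarrow> nat \<Rightarrow> nat \<Rightarrow> nat" where
  "cyclic_shift n j a = (if a \<in> {1..n} then (a - 1 + j) mod n + 1 else a)"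

lemma reversal_comp_reversal:
  assumes "j \<le> n"
  shows "reversal n 0 \<circ> reversal n j = cyclic_shift n (n - j)"
proof
  fix a
  consider "a \<in> {1..j}" | "a \<in> {j<..n}" | "a \<notin> {1..n}" by force
  then show "(reversal n 0 \<circ> reversal n j) a = cyclic_shift n (n - j) a"
  proof cases
    case 1
    then have "(a - 1 + (n - j)) mod n = a - 1 + (n - j)" using assms by (intro mod_less) auto
    then show ?thesis using 1 assms by (auto simp: reversal_def cyclic_shift_def)
  next
    case 2
    then have "a - 1 + (n - j) = (a - 1 - j) + n" by auto
    then have "(a - 1 + (n - j)) mod n = (a - 1 - j) mod n" by simp
    also have "\<dots> = a - 1 - j" using 2 by (intro mod_less) auto
    finally show ?thesis using 2 assms by (auto simp: reversal_def cyclic_shift_def)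
  qed (use assms in \<open>auto simp: reversal_def cyclic_shift_def\<close>)
qed

lemma cyclic_shift_0: "cyclic_shift n 0 = id"
  by (rule ext) (auto simp: cyclic_shift_def)

lemma cyclic_shift_comp: "cyclic_shift n j \<circ> cyclic_shift n k = cyclic_shift n (j + k)"
proof
  fix a show "(cyclic_shift n j \<circ> cyclic_shift n k) a = cyclic_shift n (j + k) a"
  proof (cases "a \<in> {1..n}")
    case True
    then have "Suc ((a - 1 + k) mod n) \<in> {1..n}" by (auto simp: Suc_le_eq)
    with True show ?thesis by (auto simp: cyclic_shift_def mod_simps add.assoc add.commute[of j])
  qed (auto simp: cyclic_shift_def)
qed

lemma cyclic_shift_permutes: "cyclic_shift n j permutes {1..n}"
proof (rule bij_imp_permutes)
  have inj: "inj_on (cyclic_shift n j) {1..n}"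
  proof (rule inj_onI)
    fix a b assume ab: "a \<in> {1..n}" "b \<in> {1..n}" "cyclic_shift n j a = cyclic_shift n j b"
    then have "[a - 1 + j = b - 1 + j] (mod n)" by (auto simp: cyclic_shift_def cong_def)
    then have "[a - 1 = b - 1] (mod n)" by (simp add: cong_add_rcancel_nat)
    then have "a - 1 = b - 1" using ab by (auto dest: cong_less_modulus_unique_nat)
    then show "a = b" using ab by auto
  qed
  moreover have "cyclic_shift n j ` {1..n} \<subseteq> {1..n}" by (auto simp: cyclic_shift_def Suc_le_eq)
  ultimately show "bij_betw (cyclic_shift n j) {1..n} {1..n}"
    by (simp add: bij_betw_def endo_inj_surj)
qed (auto simp: cyclic_shift_def)

lemma cyclic_shift_eq_id_iff:
  assumes "n > 0"
  shows "cyclic_shift n j = id \<longleftrightarrow> n dvd j"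
proof
  assume "cyclic_shift n j = id"
  then have "cyclic_shift n j 1 = 1" by simp
  then show "n dvd j" using assms by (auto simp: cyclic_shift_def)
next
  assume "n dvd j"
  then have shift: "(a - 1 + j) mod n = (a - 1) mod n" for a
    by (auto simp: mod_add_right_eq[symmetric, of _ j])
  show "cyclic_shift n j = id"
  proof
    fix a
    have "(a - 1) mod n + 1 = a" if "a \<in> {1..n}"
      using that by auto
    then show "cyclic_shift n j a = id a" unfolding cyclic_shift_def shift by simp
  qed
qed

section \<open>The Weyl group as a permutation group\<close>

text \<open>Composition with p is a right action of permutations: products are reversed. This convention turns
  left multiplication by a simple reflection into a change of positions, as in the lemmas on
  inversions.\<close>

definition perm_action :: "nat \<Rightarrow> (nat \<Rightarrow> nat) \<Rightarrow> (nat \<Rightarrow> real) \<Rightarrow> (nat \<Rightarrow> real)" where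
  "perm_action l p = (\<lambda>x \<in> euclid l. x \<circ> p)"

lemma comp_perm_in_euclid:
  assumes p: "p permutes {1..l+1}" and x: "x \<in> euclid l"
  shows "x \<circ> p \<in> euclid l"
proof -
  have "(\<Sum>i=1..l+1. (x \<circ> p) i) = (\<Sum>i=1..l+1. x i)"
    using sum.permute[OF p, of x] by simp
  moreover have "p i = i" if "i \<notin> {1..l+1}" for i
    using p that by (simp add: permutes_def)
  ultimately show ?thesis using x by (simp only: euclid_def mem_Collect_eq comp_apply) simp
qed

lemma perm_action_compose:
  assumes "p permutes {1..l+1}" "r permutes {1..l+1}"
  shows "compose (euclid l) (perm_action l p) (perm_action l r) = perm_action l (r \<circ> p)"
  unfolding compose_def perm_action_def
  by (rule restrict_ext) (simp add: comp_perm_in_euclid[OF assms(2)] comp_assoc)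

lemma perm_action_id: "perm_action l id = (\<lambda>x \<in> euclid l. x)"
  by (simp add: perm_action_def)

lemma perm_action_Bij:
  assumes p: "p permutes {1..l+1}"
  shows "perm_action l p \<in> Bij (euclid l)"
proof -
  define r where "r = inv_into UNIV p"
  have r: "r permutes {1..l+1}" "p \<circ> r = id" "r \<circ> p = id"
    using permutes_inv[OF p] permutes_inv_o[OF p] by (simp_all add: r_def)
  note closed = comp_perm_in_euclid[OF p] comp_perm_in_euclid[OF r(1)]
  have "bij_betw (perm_action l p) (euclid l) (euclid l)"
  proof (rule bij_betwI[where g = "perm_action l r"])
    show "perm_action l p \<in> euclid l \<rightarrow> euclid l" "perm_action l r \<in> euclid l \<rightarrow> euclid l"
      using closed by (simp_all add: perm_action_def)
    show "perm_action l r (perm_action l p x) = x" if "x \<in> euclid l" for x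
      using that closed(1)[OF that] by (simp add: perm_action_def comp_assoc r(2))
    show "perm_action l p (perm_action l r x) = x" if "x \<in> euclid l" for x
      using that closed(2)[OF that] by (simp add: perm_action_def comp_assoc r(3))
  qed
  then show ?thesis by (simp add: Bij_def perm_action_def)
qed

text \<open>If p and r differ at a, then the vector e_(p a) - e_(r a) separates them, having different
  coordinates at p a and r a.\<close>

lemma perm_action_inject:
  assumes p: "p permutes {1..l+1}" and r: "r permutes {1..l+1}"
    and eq: "perm_action l p = perm_action l r"
  shows "p = r"
proof (rule ccontr)
  assume "p \<noteq> r"
  then obtain a where a: "p a \<noteq> r a" by blast
  then have "a \<in> {1..l+1}" using p r by (metis permutes_not_in)
  then have mem: "p a \<in> {1..l+1}" "r a \<in> {1..l+1}"
    using permutes_in_image[OF p] permutes_in_image[OF r] by simp_all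
  define x where "x = unit_vec (p a) - unit_vec (r a)"
  have "x \<in> euclid l"
    using mem by (auto simp: x_def euclid_def unit_vec_def sum_subtractf)
  then have "x \<circ> p = x \<circ> r"
    using fun_cong[OF eq, of x] by (simp add: perm_action_def)
  from fun_cong[OF this, of a] a show False by (simp add: x_def unit_vec_def split: if_splits)
qed

lemma simple_root_in_roots: "i \<in> {1..l} \<Longrightarrow> simple_root i \<in> roots l"
  unfolding roots_def simple_root_def
  by (intro UnI1 CollectI exI[of _ i] exI[of _ "i + 1"]) auto

lemma reflection_simple_root:
  assumes i: "i \<in> {1..l}"
  shows "reflection l (simple_root i) = perm_action l (adj i)"
proof -
  have ip: "ip l (simple_root i) x = x i - x (Suc i)" for x
  proof -
    have "ip l (simple_root i) x =
        (\<Sum>k=1..l+1. (if k = i then x k else 0) - (if k = Suc i then x k else 0))"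
      unfolding ip_def by (intro sum.cong) (auto simp: simple_root_def unit_vec_def)
    then show ?thesis using i by (simp add: sum_subtractf)
  qed
  have "(\<lambda>k. x k - 2 * ip l (simple_root i) x / ip l (simple_root i) (simple_root i) * simple_root i k)
      = x \<circ> adj i" for x
    unfolding ip by (auto simp: fun_eq_iff simple_root_def unit_vec_def transpose_def field_simps)
  then show ?thesis unfolding reflection_def perm_action_def by auto
qed

context
  fixes l :: nat
begin

interpretation B: group "BijGroup (euclid l)" by (rule group_BijGroup)

lemma group_weyl_group: "group (weyl_group l)"
  unfolding weyl_group_def by simp

lemma weyl_one: "\<one>\<^bsub>weyl_group l\<^esub> = perm_action l id"
  by (simp add: weyl_group_def BijGroup_def perm_action_id)

lemma weyl_mult:
  assumes "p permutes {1..l+1}" "r permutes {1..l+1}"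
  shows "perm_action l p \<otimes>\<^bsub>weyl_group l\<^esub> perm_action l r = perm_action l (r \<circ> p)"
  using perm_action_compose[OF assms] perm_action_Bij[OF assms(1)] perm_action_Bij[OF assms(2)]
  by (simp add: weyl_group_def BijGroup_def)

lemma simple_reflection_carrier:
  assumes i: "i \<in> {1..l}"
  shows "perm_action l (adj i) \<in> carrier (weyl_group l)"
proof -
  have "adj i permutes {1..l+1}" using i by (intro adj_permutes) auto
  then have "perm_action l (adj i) \<in> carrier (BijGroup (euclid l))"
    using perm_action_Bij by (simp add: BijGroup_def)
  moreover have "perm_action l (adj i) \<in> reflection l ` roots l"
    unfolding reflection_simple_root[OF i, symmetric] using simple_root_in_roots[OF i] by (rule imageI)
  ultimately have "perm_action l (adj i) \<in> carrier (BijGroup (euclid l)) \<inter> reflection l ` roots l"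
    by (rule IntI)
  then show ?thesis
    unfolding weyl_group_def carrier_subgroup_generated by (rule generate.incl)
qed

end

lemma adj_permutes_coordinates: "i \<in> {1..l} - {j} \<Longrightarrow> adj i permutes {1..l+1}"
  by (intro adj_permutes) auto

lemma simple_reflections_eq:
  "simple_reflections l ({1..l} - {j}) = (\<lambda>i. perm_action l (adj i)) ` ({1..l} - {j})"
  unfolding simple_reflections_def by (intro image_cong refl reflection_simple_root) auto

text \<open>A letter raises the number of inversions by at most one, so a word is at least as long as the
  number of inversions of its value.\<close>

lemma word_value:
  assumes "set ss \<subseteq> simple_reflections l ({1..l} - {j})"
  shows "\<exists>p \<in> block_perms (l+1) j.
           foldr (mult (weyl_group l)) ss (one (weyl_group l)) = perm_action l p
           \<and> card (inversions (l+1) p) \<le> length ss"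
  using assms
proof (induction ss)
  case Nil
  have "inversions (l+1) id = {}" by (auto simp: inversions_def)
  then have "card (inversions (l+1) id) \<le> length []" by simp
  moreover have "foldr (mult (weyl_group l)) [] (one (weyl_group l)) = perm_action l id"
    by (simp add: weyl_one)
  ultimately show ?case using id_in_block_perms by fastforce
next
  case (Cons s ss)
  then obtain p where p: "p \<in> block_perms (l+1) j"
      "foldr (mult (weyl_group l)) ss (one (weyl_group l)) = perm_action l p"
      "card (inversions (l+1) p) \<le> length ss"
    by auto
  from Cons.prems have "s \<in> simple_reflections l ({1..l} - {j})" by simp
  then obtain i where i: "i \<in> {1..l} - {j}" "s = perm_action l (adj i)"
    unfolding simple_reflections_eq by blast
  have perm: "p permutes {1..l+1}" using p(1) by (rule block_perms_permutes)
  show ?case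
  proof (intro bexI[of _ "p \<circ> adj i"] conjI)
    show "p \<circ> adj i \<in> block_perms (l+1) j"
      using i by (intro comp_in_block_perms p adj_in_block_perms) auto
    show "foldr (mult (weyl_group l)) (s # ss) (one (weyl_group l)) = perm_action l (p \<circ> adj i)"
      using weyl_mult[OF adj_permutes_coordinates[OF i(1)] perm] by (simp add: p(2) i(2))
    show "card (inversions (l+1) (p \<circ> adj i)) \<le> length (s # ss)"
      using card_inversions_adj_le[OF perm, of i] i p(3) by simp
  qed
qed

text \<open>Sorting the permutation by removing one descent at a time gives a word that attains the lower
  bound.\<close>

lemma reduced_word:
  assumes "p \<in> block_perms (l+1) j"
  shows "\<exists>ss. set ss \<subseteq> simple_reflections l ({1..l} - {j})
           \<and> length ss = card (inversions (l+1) p)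
           \<and> foldr (mult (weyl_group l)) ss (one (weyl_group l)) = perm_action l p"
  using assms
proof (induction "card (inversions (l+1) p)" arbitrary: p)
  case 0
  have "p = id"
  proof (rule ccontr)
    assume "p \<noteq> id"
    then obtain i where "i \<in> {1..<l+1} - {j}" "p (Suc i) < p i"
      using block_perms_descent 0 by metis
    then show False using card_inversions_descent[of i "l+1" p] 0 by auto
  qed
  have "foldr (mult (weyl_group l)) [] (one (weyl_group l)) = perm_action l p"
    by (simp add: weyl_one \<open>p = id\<close>)
  then show ?case unfolding 0(1)[symmetric] by (intro exI[of _ "[]"]) simp
next
  case (Suc m)
  have "p \<noteq> id"
  proof
    assume "p = id"
    then have "inversions (l+1) p = {}" by (auto simp: inversions_def)
    then show False using Suc by simp
  qed
  then obtain i where i: "i \<in> {1..<l+1} - {j}" "p (Suc i) < p i"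
    using block_perms_descent Suc by metis
  then have card: "m = card (inversions (l+1) (p \<circ> adj i))"
    using card_inversions_descent[of i "l+1" p] Suc by auto
  have block: "p \<circ> adj i \<in> block_perms (l+1) j"
    using i by (intro comp_in_block_perms Suc.prems adj_in_block_perms)
  obtain ss where ss: "set ss \<subseteq> simple_reflections l ({1..l} - {j})"
      "length ss = card (inversions (l+1) (p \<circ> adj i))"
      "foldr (mult (weyl_group l)) ss (one (weyl_group l)) = perm_action l (p \<circ> adj i)"
    using Suc.hyps(1)[OF card block] by blast
  have i': "i \<in> {1..l} - {j}" using i by auto
  have "perm_action l (adj i) \<otimes>\<^bsub>weyl_group l\<^esub> perm_action l (p \<circ> adj i)
      = perm_action l ((p \<circ> adj i) \<circ> adj i)"
    by (rule weyl_mult[OF adj_permutes_coordinates[OF i'] block_perms_permutes[OF block]])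
  also have "(p \<circ> adj i) \<circ> adj i = p" by (simp only: comp_assoc transpose_comp_involutory comp_id)
  finally have mult: "perm_action l (adj i) \<otimes>\<^bsub>weyl_group l\<^esub> perm_action l (p \<circ> adj i) = perm_action l p" .
  have "foldr (mult (weyl_group l)) (perm_action l (adj i) # ss) (one (weyl_group l)) = perm_action l p"
    unfolding foldr.simps(2) comp_apply[of "mult (weyl_group l) _"] ss(3) by (rule mult)
  moreover have "set (perm_action l (adj i) # ss) \<subseteq> simple_reflections l ({1..l} - {j})"
    using ss(1) i' unfolding simple_reflections_eq by (simp only: list.set insert_subset) blast
  moreover have "length (perm_action l (adj i) # ss) = card (inversions (l+1) p)"
    using ss(2) card Suc.hyps(2) by simp
  ultimately show ?case by blast
qed

lemma word_length_perm_action: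
  assumes p: "p \<in> block_perms (l+1) j"
  shows "word_length (weyl_group l) (simple_reflections l ({1..l} - {j})) (perm_action l p)
       = card (inversions (l+1) p)"
  unfolding word_length_def
proof (rule Least_equality)
  show "\<exists>ss. set ss \<subseteq> simple_reflections l ({1..l} - {j}) \<and> length ss = card (inversions (l+1) p) \<and>
        foldr (mult (weyl_group l)) ss (one (weyl_group l)) = perm_action l p"
    by (rule reduced_word[OF p])
next
  fix m
  assume "\<exists>ss. set ss \<subseteq> simple_reflections l ({1..l} - {j}) \<and> length ss = m \<and>
        foldr (mult (weyl_group l)) ss (one (weyl_group l)) = perm_action l p"
  then obtain ss where ss: "set ss \<subseteq> simple_reflections l ({1..l} - {j})" "length ss = m"
      "foldr (mult (weyl_group l)) ss (one (weyl_group l)) = perm_action l p"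
    by blast
  from word_value[OF ss(1)] obtain r where "r \<in> block_perms (l+1) j"
      "perm_action l p = perm_action l r" "card (inversions (l+1) r) \<le> m"
    unfolding ss(2,3) by blast
  then show "card (inversions (l+1) p) \<le> m"
    using perm_action_inject[OF block_perms_permutes[OF p] block_perms_permutes] by metis
qed

lemma generate_simple_reflections:
  "generate (weyl_group l) (simple_reflections l ({1..l} - {j})) = perm_action l ` block_perms (l+1) j"
  (is "generate ?W ?S = _")
proof
  interpret W: group ?W by (rule group_weyl_group)
  have refl: "\<exists>i \<in> {1..l} - {j}. s = perm_action l (adj i)" if "s \<in> ?S" for s
    using that unfolding simple_reflections_eq by auto
  have adj: "adj i \<in> block_perms (l+1) j" if "i \<in> {1..l} - {j}" for i
    using that by (intro adj_in_block_perms) auto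
  show "generate ?W ?S \<subseteq> perm_action l ` block_perms (l+1) j"
  proof
    fix w assume "w \<in> generate ?W ?S"
    then show "w \<in> perm_action l ` block_perms (l+1) j"
    proof induction
      case one
      then show ?case using weyl_one id_in_block_perms by auto
    next
      case (incl s)
      then show ?case using refl adj by blast
    next
      case (inv s)
      then obtain i where i: "i \<in> {1..l} - {j}" "s = perm_action l (adj i)" using refl by blast
      then have carr: "s \<in> carrier ?W" using simple_reflection_carrier by auto
      have "s \<otimes>\<^bsub>?W\<^esub> s = perm_action l (adj i \<circ> adj i)"
        unfolding i(2) by (rule weyl_mult[OF adj_permutes_coordinates[OF i(1)] adj_permutes_coordinates[OF i(1)]])
      then have "s \<otimes>\<^bsub>?W\<^esub> s = \<one>\<^bsub>?W\<^esub>" by (simp add: weyl_one)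
      then have "inv\<^bsub>?W\<^esub> s = s" using W.inv_equality carr by blast
      then show ?case using i adj by auto
    next
      case (eng v w)
      then show ?case
      proof (elim imageE)
        fix p r assume pr: "p \<in> block_perms (l+1) j" "r \<in> block_perms (l+1) j"
          and vw: "v = perm_action l p" "w = perm_action l r"
        have "v \<otimes>\<^bsub>?W\<^esub> w = perm_action l (r \<circ> p)"
          unfolding vw by (intro weyl_mult block_perms_permutes[of _ _ j] pr)
        then show ?thesis using comp_in_block_perms[OF pr(2,1)] by blast
      qed
    qed
  qed
  have word: "foldr (mult ?W) ss \<one>\<^bsub>?W\<^esub> \<in> generate ?W ?S" if "set ss \<subseteq> ?S" for ss
    using that by (induction ss) (auto intro: generate.intros)
  show "perm_action l ` block_perms (l+1) j \<subseteq> generate ?W ?S"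
  proof clarify
    fix p assume "p \<in> block_perms (l+1) j"
    then obtain ss where "set ss \<subseteq> ?S" "foldr (mult ?W) ss \<one>\<^bsub>?W\<^esub> = perm_action l p"
      using reduced_word by blast
    with word show "perm_action l p \<in> generate ?W ?S" by metis
  qed
qed

lemma longest_element_eq:
  assumes j: "j \<le> l + 1"
  shows "longest_element (weyl_group l) (simple_reflections l ({1..l} - {j}))
       = perm_action l (reversal (l+1) j)"
  unfolding longest_element_def generate_simple_reflections
proof (rule the_equality)
  let ?len = "word_length (weyl_group l) (simple_reflections l ({1..l} - {j}))"
  have rev: "reversal (l+1) j \<in> block_perms (l+1) j" using reversal_in_block_perms[OF j] .
  have le: "card (inversions (l+1) p) \<le> card (inversions (l+1) (reversal (l+1) j))"
    if "p \<in> block_perms (l+1) j" for p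
    by (intro card_mono finite_inversions inversions_subset_reversal that j)
  show "is_arg_max ?len (\<lambda>v. v \<in> perm_action l ` block_perms (l+1) j) (perm_action l (reversal (l+1) j))"
    using rev le unfolding is_arg_max_def by (auto simp only: word_length_perm_action not_less[symmetric])
  fix w assume w: "is_arg_max ?len (\<lambda>v. v \<in> perm_action l ` block_perms (l+1) j) w"
  then obtain p where p: "p \<in> block_perms (l+1) j" "w = perm_action l p"
    by (auto simp: is_arg_max_def)
  have "\<not> ?len w < ?len (perm_action l (reversal (l+1) j))"
    using w rev by (auto simp: is_arg_max_def)
  then have "card (inversions (l+1) (reversal (l+1) j)) \<le> card (inversions (l+1) p)"
    unfolding p(2) word_length_perm_action[OF rev] word_length_perm_action[OF p(1)] by simp
  with card_inversions_max_iff[OF p(1) j] p(2) show "w = perm_action l (reversal (l+1) j)" by simp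
qed

text \<open>Two block reversals in succession compose to a shift. It is through n - j places, the inverse of the shift through j, because
  permutations act from the right. Both have the same order, and gcd n (n - j) = gcd n j.\<close>

lemma omega_eq:
  assumes "j \<le> l"
  shows "omega l j = perm_action l (cyclic_shift (l+1) (l + 1 - j))"
proof (cases "j = 0")
  case True
  then have "cyclic_shift (l+1) (l + 1 - j) = id"
    by (subst cyclic_shift_eq_id_iff) simp_all
  then show ?thesis unfolding omega_def weyl_one \<open>j = 0\<close> by (simp only: refl if_True)
next
  case False
  have "simple_reflections l {1..l} = simple_reflections l ({1..l} - {0})" by simp
  then have "omega l j = perm_action l (reversal (l+1) j) \<otimes>\<^bsub>weyl_group l\<^esub> perm_action l (reversal (l+1) 0)"
    using False assms longest_element_eq[of j l] longest_element_eq[of 0 l] by (simp add: omega_def)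
  also have "\<dots> = perm_action l (reversal (l+1) 0 \<circ> reversal (l+1) j)"
    using assms by (intro weyl_mult block_perms_permutes[OF reversal_in_block_perms]) auto
  also have "\<dots> = perm_action l (cyclic_shift (l+1) (l + 1 - j))"
    using assms by (subst reversal_comp_reversal) auto
  finally show ?thesis .
qed

lemma weyl_pow_cyclic_shift:
  "perm_action l (cyclic_shift (l+1) j) [^]\<^bsub>weyl_group l\<^esub> (k::nat) = perm_action l (cyclic_shift (l+1) (k * j))"
proof (induction k)
  case 0
  show ?case by (simp only: nat_pow_0 weyl_one mult_0 cyclic_shift_0)
next
  case (Suc k)
  have "perm_action l (cyclic_shift (l+1) j) [^]\<^bsub>weyl_group l\<^esub> Suc k
      = perm_action l (cyclic_shift (l+1) (k * j)) \<otimes>\<^bsub>weyl_group l\<^esub> perm_action l (cyclic_shift (l+1) j)"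
    using Suc by (simp add: nat_pow_def)
  also have "\<dots> = perm_action l (cyclic_shift (l+1) j \<circ> cyclic_shift (l+1) (k * j))"
    by (rule weyl_mult[OF cyclic_shift_permutes cyclic_shift_permutes])
  finally show ?case by (simp only: cyclic_shift_comp mult_Suc)
qed

lemma ord_cyclic_shift:
  "group.ord (weyl_group l) (perm_action l (cyclic_shift (l+1) j)) = (l+1) div gcd (l+1) j"
proof -
  interpret W: group "weyl_group l" by (rule group_weyl_group)
  have "perm_action l (cyclic_shift (l+1) j) [^]\<^bsub>weyl_group l\<^esub> k = \<one>\<^bsub>weyl_group l\<^esub>
      \<longleftrightarrow> (l+1) div gcd (l+1) j dvd k" for k :: nat
  proof -
    have "perm_action l (cyclic_shift (l+1) (k * j)) = perm_action l id \<longleftrightarrow> cyclic_shift (l+1) (k * j) = id"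
      using perm_action_inject[OF cyclic_shift_permutes permutes_id] by metis
    then show ?thesis
      unfolding weyl_pow_cyclic_shift weyl_one using cyclic_shift_eq_id_iff[of "l+1"] dvd_mult_iff_div_gcd[of "l+1"] by simp
  qed
  then show ?thesis
    unfolding W.ord_def by (intro some_equality allI) (metis dvd_antisym dvd_refl)+
qed

section \<open>Counting equivariant labelings\<close>

text \<open>The number q div gcd q c is the additive order of c modulo q.\<close>

definition step_residues :: "nat \<Rightarrow> nat \<Rightarrow> nat set" where
  "step_residues q d = {c \<in> {0..<q}. q div gcd q c = d}"

text \<open>An element c has order d iff its gcd with q is q / d. The totient counts such c in {0<..q},
  where the zero residue is represented by q instead of 0.\<close>

lemma card_step_residues:
  assumes "q > 0" and d: "d dvd q"
  shows "card (step_residues q d) = totient d"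
proof -
  have d0: "d > 0" using assms by (metis dvd_0_left_iff gr0I)
  obtain m where m: "q = d * m" using d by (elim dvdE)
  have m0: "m > 0" using m assms by simp
  have iff: "q div gcd q c = d \<longleftrightarrow> gcd c q = m" for c
  proof
    assume "q div gcd q c = d"
    then have "q = d * gcd c q" by (metis dvd_div_mult_self gcd.commute gcd_dvd1)
    then show "gcd c q = m" using m d0 by simp
  next
    assume "gcd c q = m"
    then show "q div gcd q c = d" using m m0 by (simp add: gcd.commute)
  qed
  have "bij_betw (\<lambda>c. c mod q) {c \<in> {0<..q}. gcd c q = m} (step_residues q d)"
  proof (rule bij_betwI[where g = "\<lambda>c. if c = 0 then q else c"])
    show "(\<lambda>c. c mod q) \<in> {c \<in> {0<..q}. gcd c q = m} \<rightarrow> step_residues q d"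
      using assms by (auto simp: step_residues_def iff)
    show "(\<lambda>c. if c = 0 then q else c) \<in> step_residues q d \<rightarrow> {c \<in> {0<..q}. gcd c q = m}"
      using assms by (auto simp: step_residues_def iff)
  next
    fix c assume "c \<in> {c \<in> {0<..q}. gcd c q = m}"
    then show "(if c mod q = 0 then q else c mod q) = c"
      by (cases "c = q") auto
  next
    fix c assume "c \<in> step_residues q d"
    then show "(if c = 0 then q else c) mod q = c" by (auto simp: step_residues_def)
  qed
  then have "card (step_residues q d) = card {c \<in> {0<..q}. gcd c q = m}"
    by (rule bij_betw_same_card[symmetric])
  also have "\<dots> = totient (q div m)"
    using assms m by (intro card_gcd_eq_totient) auto
  also have "q div m = d" using m m0 by simp
  finally show ?thesis .
qed

text \<open>The possible labels of the orbit representatives 0, ..., g-1. Labels in the same class modulo m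
  would make two orbits overlap.\<close>

definition transversals :: "nat \<Rightarrow> nat \<Rightarrow> nat \<Rightarrow> (nat \<Rightarrow> nat) set" where
  "transversals q m g =
     {h \<in> {0..<g} \<rightarrow>\<^sub>E {0..<q}. h 0 = 0 \<and> inj_on (\<lambda>r. h r mod m) {0..<g}}"

lemma card_residues_in:
  assumes "B \<subseteq> {0..<m}"
  shows "card {y \<in> {0..<d * m}. y mod m \<in> B} = d * card (B :: nat set)"
proof (cases "m = 0")
  case True
  then show ?thesis using assms by simp
next
  case False
  have "bij_betw (\<lambda>y. (y div m, y mod m)) {y \<in> {0..<d * m}. y mod m \<in> B} ({0..<d} \<times> B)"
  proof (rule bij_betwI[where g = "\<lambda>(a, b). a * m + b"])
    show "(\<lambda>y. (y div m, y mod m)) \<in> {y \<in> {0..<d * m}. y mod m \<in> B} \<rightarrow> {0..<d} \<times> B"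
      by (auto simp: less_mult_imp_div_less)
    have "a * m + b < d * m" if "a < d" "b < m" for a b
    proof -
      have "a * m + b < Suc a * m" using that by simp
      also have "\<dots> \<le> d * m" using that by (intro mult_le_mono1) simp
      finally show ?thesis .
    qed
    then show "(\<lambda>(a, b). a * m + b) \<in> {0..<d} \<times> B \<rightarrow> {y \<in> {0..<d * m}. y mod m \<in> B}"
      using assms by fastforce
  qed (use assms in auto)
  then show ?thesis by (simp add: bij_betw_same_card card_cartesian_product)
qed

lemma transversals_1: "q > 0 \<Longrightarrow> transversals q m 1 = {\<lambda>r\<in>{0..<1}. 0}"
  by (auto simp: transversals_def PiE_def extensional_def fun_eq_iff)

lemma bij_betw_transversals_Suc:
  assumes "g > 0"
  shows "bij_betw (\<lambda>(h, y). h(g := y))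
           (SIGMA h:transversals q m g. {y \<in> {0..<q}. y mod m \<notin> (\<lambda>r. h r mod m) ` {0..<g}})
           (transversals q m (Suc g))"
    (is "bij_betw ?F ?A ?B")
proof (rule bij_betwI[where g = "\<lambda>h. (restrict h {0..<g}, h g)"])
  have un: "{0..<Suc g} = insert g {0..<g}" by auto
  show "?F \<in> ?A \<rightarrow> ?B"
  proof (rule funcsetI, clarify)
    fix h y assume h: "h \<in> transversals q m g" and y: "y \<in> {0..<q}" "y mod m \<notin> (\<lambda>r. h r mod m) ` {0..<g}"
    have eq: "(h(g := y)) r mod m = h r mod m" if "r \<in> {0..<g}" for r using that by simp
    have "inj_on (\<lambda>r. (h(g := y)) r mod m) {0..<g}"
      using h unfolding transversals_def by (subst inj_on_cong[OF eq]) simp_all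
    moreover have "(\<lambda>r. (h(g := y)) r mod m) ` {0..<g} = (\<lambda>r. h r mod m) ` {0..<g}"
      by (rule image_cong[OF refl eq])
    ultimately have "inj_on (\<lambda>r. (h(g := y)) r mod m) {0..<Suc g}"
      unfolding un inj_on_insert using y by simp
    moreover have "h(g := y) \<in> {0..<Suc g} \<rightarrow>\<^sub>E {0..<q}"
      using h y unfolding un by (intro PiE_fun_upd) (auto simp: transversals_def)
    ultimately show "h(g := y) \<in> ?B"
      using h assms by (simp add: transversals_def)
  qed
  show "(\<lambda>h. (restrict h {0..<g}, h g)) \<in> ?B \<rightarrow> ?A"
  proof
    fix h assume h: "h \<in> ?B"
    have inj: "inj_on (\<lambda>r. h r mod m) (insert g {0..<g})"
      using h by (simp add: transversals_def un)
    have eq: "restrict h {0..<g} r mod m = h r mod m" if "r \<in> {0..<g}" for r using that by simp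
    have "inj_on (\<lambda>r. h r mod m) {0..<g}" using inj by (rule inj_on_subset) blast
    then have "inj_on (\<lambda>r. restrict h {0..<g} r mod m) {0..<g}"
      by (subst inj_on_cong[OF eq]) simp_all
    moreover have h': "h \<in> {0..<Suc g} \<rightarrow>\<^sub>E {0..<q}" "h 0 = 0" using h by (simp_all add: transversals_def)
    then have "restrict h {0..<g} \<in> {0..<g} \<rightarrow>\<^sub>E {0..<q}"
      by (intro restrict_PiE_iff[THEN iffD2]) auto
    ultimately have "restrict h {0..<g} \<in> transversals q m g"
      using h' assms unfolding transversals_def by simp
    moreover have "h g mod m \<notin> (\<lambda>r. restrict h {0..<g} r mod m) ` {0..<g}"
      using inj unfolding inj_on_insert by (subst image_cong[OF refl eq]) simp_all
    ultimately show "(restrict h {0..<g}, h g) \<in> ?A"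
      using h by (auto simp: transversals_def)
  qed
  show "(restrict (?F x) {0..<g}, ?F x g) = x" if x: "x \<in> ?A" for x
  proof -
    obtain h y where hy: "x = (h, y)" "h \<in> transversals q m g" using x by blast
    then have "h \<in> extensional {0..<g}" by (simp add: transversals_def PiE_def)
    moreover have "restrict (h(g := y)) {0..<g} = restrict h {0..<g}"
      by (rule restrict_ext) simp
    ultimately show ?thesis using hy by (simp add: extensional_restrict)
  qed
  show "?F (restrict h {0..<g}, h g) = h" if h: "h \<in> ?B" for h
  proof
    fix r
    have "h \<in> extensional {0..<Suc g}" using h by (simp add: transversals_def PiE_def)
    then have "h r = undefined" if "r > g" using that by (simp add: extensional_def)
    then show "?F (restrict h {0..<g}, h g) r = h r"
      by (cases r g rule: linorder_cases) simp_all
  qed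
qed

lemma finite_transversals: "finite (transversals q m g)"
  by (rule finite_subset[of _ "{0..<g} \<rightarrow>\<^sub>E {0..<q}"]) (auto simp: transversals_def intro: finite_PiE)

text \<open>A new label avoids the classes modulo m of the g labels present, each of which has d elements below
  q. If m = g then no label is left and the factor q - d g is zero; later factors may be negative,
  which is why the product is taken over the integers.\<close>

lemma card_transversals:
  assumes q: "q = d * m" "q > 0" and "g \<ge> 1"
  shows "int (card (transversals q m g)) = (\<Prod>k\<in>{1..<g}. int q - int d * int k)"
  using \<open>g \<ge> 1\<close>
proof (induction g rule: dec_induct)
  case base
  then show ?case using transversals_1[OF q(2)] by simp
next
  case (step g)
  have fibre: "int (card {y \<in> {0..<q}. y mod m \<notin> (\<lambda>r. h r mod m) ` {0..<g}}) = int q - int d * int g"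
    if h: "h \<in> transversals q m g" for h
  proof -
    let ?A = "(\<lambda>r. h r mod m) ` {0..<g}"
    have "m > 0" using q by simp
    then have A: "?A \<subseteq> {0..<m}" by auto
    have "card ?A = g" using h by (simp add: transversals_def card_image)
    then have "card ({0..<m} - ?A) = m - g" "g \<le> m"
      using card_Diff_subset[OF _ A] card_mono[OF _ A] by simp_all
    moreover have "{y \<in> {0..<q}. y mod m \<notin> ?A} = {y \<in> {0..<d * m}. y mod m \<in> {0..<m} - ?A}"
      using \<open>m > 0\<close> q by auto
    ultimately show ?thesis
      using card_residues_in[of "{0..<m} - ?A" m d] q by (simp add: of_nat_diff algebra_simps)
  qed
  have "card (transversals q m (Suc g)) =
      card (SIGMA h:transversals q m g. {y \<in> {0..<q}. y mod m \<notin> (\<lambda>r. h r mod m) ` {0..<g}})"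
    using bij_betw_transversals_Suc[of g q m] step by (simp add: bij_betw_same_card)
  also have "\<dots> = (\<Sum>h\<in>transversals q m g. card {y \<in> {0..<q}. y mod m \<notin> (\<lambda>r. h r mod m) ` {0..<g}})"
    by (intro card_SigmaI finite_transversals) auto
  finally have "int (card (transversals q m (Suc g))) = (\<Sum>h\<in>transversals q m g. int q - int d * int g)"
    using fibre by simp
  also have "\<dots> = (\<Prod>k\<in>{1..<g}. int q - int d * int k) * (int q - int d * int g)"
    using step by simp
  also have "\<dots> = (\<Prod>k\<in>{1..<Suc g}. int q - int d * int k)"
    using step by (simp add: prod.atLeastLessThan_Suc)
  finally show ?case .
qed

text \<open>The pairs (r, k) with r < gcd n j and k modulo n / gcd n j are coordinates on the residues modulo n:
  r says in which orbit of the shift by j a position lies, k how many shifts lead to it.\<close>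

lemma cong_position_iff:
  fixes n j r r' k k' :: nat
  assumes "n > 0" "r < gcd n j" "r' < gcd n j"
  shows "[r + k * j = r' + k' * j] (mod n) \<longleftrightarrow> r = r' \<and> [k = k'] (mod n div gcd n j)"
proof -
  have "r = r'" if "[r + k * j = r' + k' * j] (mod n)"
  proof -
    have "[r + k * j = r' + k' * j] (mod gcd n j)"
      using that by (rule cong_dvd_modulus_nat) simp
    moreover have "[a + b * j = a] (mod gcd n j)" for a b
      by (simp add: cong_add_lcancel_0_nat cong_0_iff)
    ultimately have "[r = r'] (mod gcd n j)" by (metis cong_sym cong_trans)
    then show ?thesis using assms by (simp add: cong_less_modulus_unique_nat)
  qed
  then show ?thesis
    using cong_mult_iff_div_gcd[OF assms(1), of k j k'] by (auto simp: cong_add_lcancel_nat)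
qed

text \<open>The multiples of j modulo n are the multiples of gcd n j, so i can be reached from its remainder
  modulo gcd n j.\<close>

lemma ex_position:
  fixes n j i :: nat
  assumes "n > 0" "i < n"
  shows "\<exists>r k. r < gcd n j \<and> i = (r + k * j) mod n"
proof -
  have g: "gcd n j > 0" using assms by simp
  have "gcd j n dvd i - i mod gcd n j"
    by (simp add: gcd.commute minus_mod_eq_mult_div)
  then obtain k where "[j * k = i - i mod gcd n j] (mod n)"
    using cong_solve_dvd_nat by blast
  then have "[i mod gcd n j + j * k = i mod gcd n j + (i - i mod gcd n j)] (mod n)"
    by (subst cong_add_lcancel_nat)
  then have "i = (i mod gcd n j + k * j) mod n"
    using assms by (simp add: cong_def mult.commute)
  then show ?thesis using g by (intro exI[of _ "i mod gcd n j"] exI[of _ k]) simp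
qed

text \<open>The points of the complement modulo q, by their residues modulo q relative to the first
  coordinate; \<open>bij_betw_labelings_complement\<close> makes this precise.\<close>

definition labelings :: "nat \<Rightarrow> nat \<Rightarrow> (nat \<Rightarrow> nat) set" where
  "labelings n q = {f \<in> {0..<n} \<rightarrow>\<^sub>E {0..<q}. f 0 = 0 \<and> inj_on f {0..<n}}"

text \<open>The labelings to which the shift by j adds a constant. Since f 0 = 0, this constant can only be
  the label of the position j mod n.\<close>

definition equivariant :: "nat \<Rightarrow> nat \<Rightarrow> nat \<Rightarrow> (nat \<Rightarrow> nat) set" where
  "equivariant n j q =
     {f \<in> labelings n q. \<forall>i<n. f ((i + j) mod n) = (f i + f (j mod n)) mod q}"

lemma equivariant_iterate:
  assumes f: "f \<in> equivariant n j q" and "i < n"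
  shows "f ((i + k * j) mod n) = (f i + k * f (j mod n)) mod q"
proof (induction k)
  case 0
  have "f i < q" using f \<open>i < n\<close> by (auto simp: equivariant_def labelings_def)
  then show ?case using \<open>i < n\<close> by simp
next
  case (Suc k)
  have "(i + Suc k * j) mod n = ((i + k * j) mod n + j) mod n"
    unfolding mod_add_left_eq mult_Suc by (simp only: ac_simps)
  moreover have "(i + k * j) mod n < n" using \<open>i < n\<close> by simp
  ultimately have "f ((i + Suc k * j) mod n) = (f ((i + k * j) mod n) + f (j mod n)) mod q"
    using f by (simp add: equivariant_def labelings_def)
  also have "\<dots> = (f i + Suc k * f (j mod n)) mod q"
    unfolding Suc mod_add_left_eq mult_Suc by (simp only: ac_simps)
  finally show ?case .
qed

text \<open>Since f is injective, a multiple k of the label increment vanishes modulo q iff the k-fold shift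
  returns to the position 0.\<close>

lemma equivariant_step:
  assumes f: "f \<in> equivariant n j q" and "n > 0"
  shows "f (j mod n) \<in> step_residues q (n div gcd n j)"
proof -
  let ?c = "f (j mod n)"
  have c: "?c < q" using f \<open>n > 0\<close> by (auto simp: equivariant_def labelings_def)
  then have "q > 0" by simp
  have "n div gcd n j dvd k \<longleftrightarrow> q div gcd q ?c dvd k" for k
  proof -
    have "n div gcd n j dvd k \<longleftrightarrow> (0 + k * j) mod n = 0"
      using dvd_mult_iff_div_gcd[OF \<open>n > 0\<close>] by (simp add: mod_eq_0_iff_dvd)
    also have "\<dots> \<longleftrightarrow> f ((0 + k * j) mod n) = f 0"
      using f \<open>n > 0\<close> inj_on_eq_iff[of f "{0..<n}" "(0 + k * j) mod n" 0] by (auto simp: equivariant_def labelings_def)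
    also have "\<dots> \<longleftrightarrow> q dvd k * ?c"
      using f equivariant_iterate[OF f \<open>n > 0\<close>, of k]
      by (simp add: equivariant_def labelings_def mod_eq_0_iff_dvd)
    also have "\<dots> \<longleftrightarrow> q div gcd q ?c dvd k" by (rule dvd_mult_iff_div_gcd[OF \<open>q > 0\<close>])
    finally show ?thesis .
  qed
  then have "n div gcd n j = q div gcd q ?c" by (metis dvd_antisym dvd_refl)
  then show ?thesis using c by (simp add: step_residues_def)
qed

text \<open>The increment c generates the multiples of m modulo q. If two representatives have labels congruent
  modulo m, then some iterated shift of one has the label of the other, so they lie in the same
  orbit.\<close>

lemma equivariant_restrict:
  assumes f: "f \<in> equivariant n j q" and "n > 0" and q: "q = n div gcd n j * m" "q > 0"
  shows "restrict f {0..<gcd n j} \<in> transversals q m (gcd n j)"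
proof -
  let ?c = "f (j mod n)" and ?g = "gcd n j"
  have g: "?g > 0" "?g \<le> n" using \<open>n > 0\<close> by (simp_all add: gcd_le1_nat)
  have "q div gcd q ?c = n div ?g" using equivariant_step[OF f \<open>n > 0\<close>] by (simp add: step_residues_def)
  then have "q = n div ?g * gcd q ?c" by (metis dvd_div_mult_self gcd_dvd1)
  then have m: "gcd ?c q = m" using q by (simp add: gcd.commute)
  have less: "f r < q" if "r < ?g" for r using f that g by (auto simp: equivariant_def labelings_def)
  have "r = r'" if r: "r < ?g" "r' < ?g" and eq: "f r mod m = f r' mod m" for r r'
  proof -
    have mq: "m dvd q" using q by simp
    have "[f r + q = f r' + 0] (mod m)"
      using eq mq by (intro cong_add) (auto simp: cong_def)
    then have "m dvd f r + q - f r'"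
      using less[OF r(2)] by (subst (asm) cong_altdef_nat) auto
    then obtain k where "[?c * k = f r + q - f r'] (mod q)"
      using cong_solve_dvd_nat[of ?c q] m by metis
    then have "[f r' + ?c * k = f r' + (f r + q - f r')] (mod q)" by (simp add: cong_add_lcancel_nat)
    then have "[f r' + k * ?c = f r] (mod q)"
      using less[OF r(2)] by (simp add: mult.commute cong_def)
    then have "f ((r' + k * j) mod n) = f r"
      using equivariant_iterate[OF f, of r' k] r g less[OF r(1)] by (simp add: cong_def)
    moreover have "inj_on f {0..<n}" using f by (simp add: equivariant_def labelings_def)
    ultimately have "(r' + k * j) mod n = r"
      using \<open>n > 0\<close> less_le_trans[OF r(1) g(2)] by (auto dest!: inj_onD)
    then have "[r' + k * j = r + 0 * j] (mod n)" using r g by (simp add: cong_def)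
    then show ?thesis using cong_position_iff[OF \<open>n > 0\<close> r(2,1)] by blast
  qed
  then have "inj_on (\<lambda>r. f r mod m) {0..<?g}"
    by (intro inj_onI) simp
  then have "inj_on (\<lambda>r. restrict f {0..<?g} r mod m) {0..<?g}"
    by (subst inj_on_cong[of _ _ "\<lambda>r. f r mod m"]) simp_all
  moreover have "f 0 = 0" using f by (simp add: equivariant_def labelings_def)
  moreover have "restrict f {0..<?g} \<in> {0..<?g} \<rightarrow>\<^sub>E {0..<q}" using less by auto
  ultimately show ?thesis using g unfolding transversals_def by simp
qed

text \<open>Conversely, the value h r + k c modulo q at the position r + k j does not depend on the choice of k,
  because c has the same order modulo q as j modulo n.\<close>

lemma ex_equivariant:
  assumes "n > 0" and q: "q = n div gcd n j * m" "q > 0"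
    and c: "c \<in> step_residues q (n div gcd n j)" and h: "h \<in> transversals q m (gcd n j)"
  shows "\<exists>f \<in> equivariant n j q. f (j mod n) = c \<and> restrict f {0..<gcd n j} = h"
proof -
  let ?g = "gcd n j" and ?d = "n div gcd n j"
  have g: "?g > 0" "?g \<le> n" using \<open>n > 0\<close> by (simp_all add: gcd_le1_nat)
  have cq: "c < q" "q div gcd q c = ?d" using c by (simp_all add: step_residues_def)
  have "q = ?d * gcd q c" using cq(2) by (metis dvd_div_mult_self gcd_dvd1)
  then have "m = gcd q c" using q by simp
  then have m: "m dvd c" "m dvd q" by simp_all
  have cc: "[k * c = k' * c] (mod q) \<longleftrightarrow> [k = k'] (mod ?d)" for k k'
    using cong_mult_iff_div_gcd[OF q(2), of k c k'] cq(2) by simp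
  have "\<exists>v. \<forall>r k. r < ?g \<longrightarrow> i = (r + k * j) mod n \<longrightarrow> v = (h r + k * c) mod q" if "i < n" for i
  proof -
    obtain r k where rk: "r < ?g" "i = (r + k * j) mod n" using ex_position[OF \<open>n > 0\<close> \<open>i < n\<close>] by blast
    have "(h r + k * c) mod q = (h r' + k' * c) mod q" if "r' < ?g" "i = (r' + k' * j) mod n" for r' k'
    proof -
      have "[r + k * j = r' + k' * j] (mod n)" using rk that by (simp add: cong_def)
      then have "r = r'" "[k * c = k' * c] (mod q)"
        using cong_position_iff[OF \<open>n > 0\<close> rk(1) that(1)] cc by simp_all
      then show ?thesis by (simp add: cong_def[symmetric] cong_add_lcancel_nat)
    qed
    then show ?thesis by blast
  qed
  then obtain v where v: "\<And>i r k. i < n \<Longrightarrow> r < ?g \<Longrightarrow> i = (r + k * j) mod n \<Longrightarrow> v i = (h r + k * c) mod q"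
    using that[of "\<lambda>i. SOME v. \<forall>r k. r < ?g \<longrightarrow> i = (r + k * j) mod n \<longrightarrow> v = (h r + k * c) mod q"]
    by (metis (no_types, lifting) someI_ex)
  define f where "f = restrict v {0..<n}"
  have f: "f ((r + k * j) mod n) = (h r + k * c) mod q" if "r < ?g" for r k
    using v[OF _ that refl, of k] \<open>n > 0\<close> by (simp add: f_def)
  have h0: "h 0 = 0" and hless: "r < ?g \<Longrightarrow> h r < q" for r
    using h by (auto simp: transversals_def)
  have f_h: "f r = h r" if "r < ?g" for r
    using f[OF that, of 0] that g hless[OF that] by simp
  have fj: "f (j mod n) = c" using f[OF g(1), of 1] h0 cq by simp
  have inj: "inj_on f {0..<n}"
  proof (rule inj_onI)
    fix i i' assume i: "i \<in> {0..<n}" "i' \<in> {0..<n}" and eq: "f i = f i'"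
    obtain r k where rk: "r < ?g" "i = (r + k * j) mod n" using ex_position[OF \<open>n > 0\<close>] i by (metis atLeastLessThan_iff)
    obtain r' k' where rk': "r' < ?g" "i' = (r' + k' * j) mod n" using ex_position[OF \<open>n > 0\<close>] i by (metis atLeastLessThan_iff)
    have cong: "[h r + k * c = h r' + k' * c] (mod q)"
      using eq f[OF rk(1)] f[OF rk'(1)] rk rk' by (simp add: cong_def)
    then have "[h r + k * c = h r' + k' * c] (mod m)" using m(2) by (rule cong_dvd_modulus_nat)
    moreover have "[a + b * c = a] (mod m)" for a b
      using m(1) by (simp add: cong_add_lcancel_0_nat cong_0_iff)
    ultimately have "[h r = h r'] (mod m)" by (metis cong_sym cong_trans)
    then have "h r mod m = h r' mod m" by (simp add: cong_def)
    moreover have "inj_on (\<lambda>r. h r mod m) {0..<?g}" using h by (simp add: transversals_def)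
    ultimately have "r = r'" using rk(1) rk'(1) by (auto dest!: inj_onD)
    with cong have "[k = k'] (mod ?d)" by (simp add: cong_add_lcancel_nat cc)
    with \<open>r = r'\<close> have "[r + k * j = r' + k' * j] (mod n)"
      using cong_position_iff[OF \<open>n > 0\<close> rk(1) rk'(1)] by blast
    then show "i = i'" using rk rk' by (simp add: cong_def)
  qed
  have "f \<in> equivariant n j q"
    unfolding equivariant_def labelings_def
  proof (intro CollectI conjI allI impI)
    show "f \<in> {0..<n} \<rightarrow>\<^sub>E {0..<q}"
    proof (rule PiE_I)
      fix i assume "i \<in> {0..<n}"
      then obtain r k where "r < ?g" "i = (r + k * j) mod n"
        using ex_position[OF \<open>n > 0\<close>] by (metis atLeastLessThan_iff)
      then show "f i \<in> {0..<q}" using f q by simp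
    qed (simp add: f_def)
    show "f 0 = 0" using f_h[OF g(1)] h0 by simp
    show "inj_on f {0..<n}" by (rule inj)
    fix i assume "i < n"
    then obtain r k where rk: "r < ?g" "i = (r + k * j) mod n" using ex_position[OF \<open>n > 0\<close>] by blast
    have "(i + j) mod n = (r + Suc k * j) mod n"
      unfolding rk(2) mod_add_left_eq mult_Suc by (simp only: ac_simps)
    then have "f ((i + j) mod n) = (h r + Suc k * c) mod q" using f[OF rk(1), of "Suc k"] by simp
    also have "\<dots> = (f i + c) mod q"
      unfolding rk(2) f[OF rk(1)] mod_add_left_eq mult_Suc by (simp only: ac_simps)
    finally show "f ((i + j) mod n) = (f i + f (j mod n)) mod q" using fj by simp
  qed
  moreover have "restrict f {0..<?g} = h"
  proof
    fix r show "restrict f {0..<?g} r = h r"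
      using f_h h by (cases "r < ?g") (auto simp: transversals_def PiE_def extensional_def)
  qed
  ultimately show ?thesis using fj by blast
qed

text \<open>The label increment and the labels of the orbit representatives determine the labeling and can be
  prescribed independently. If d does not divide q, no increment has order d.\<close>

lemma card_equivariant:
  assumes "n > 0" "q > 0"
  shows "int (card (equivariant n j q)) =
    (if n div gcd n j dvd q
     then int (totient (n div gcd n j)) * (\<Prod>k\<in>{1..<gcd n j}. int q - int (n div gcd n j) * int k)
     else 0)"
proof (cases "n div gcd n j dvd q")
  case False
  have "n div gcd n j dvd q" if f: "f \<in> equivariant n j q" for f
  proof -
    have "q div gcd q (f (j mod n)) = n div gcd n j"
      using equivariant_step[OF f \<open>n > 0\<close>] by (simp add: step_residues_def)
    moreover have "q = q div gcd q (f (j mod n)) * gcd q (f (j mod n))" by simp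
    ultimately show ?thesis by (metis dvd_triv_left)
  qed
  with False have "equivariant n j q = {}" by blast
  then show ?thesis using False by simp
next
  case True
  then obtain m where m: "q = n div gcd n j * m" by (elim dvdE)
  let ?F = "\<lambda>f. (f (j mod n), restrict f {0..<gcd n j})"
  have inj: "inj_on ?F (equivariant n j q)"
  proof (rule inj_onI)
    fix f f' assume ff: "f \<in> equivariant n j q" "f' \<in> equivariant n j q" "?F f = ?F f'"
    have "f i = f' i" for i
    proof (cases "i < n")
      case True
      then obtain r k where rk: "r < gcd n j" "i = (r + k * j) mod n"
        using ex_position[OF \<open>n > 0\<close>] by blast
      have rn: "r < n" using rk(1) gcd_le1_nat[of n j] \<open>n > 0\<close> by linarith
      have "f r = f' r" using ff(3) rk(1) by (metis Pair_inject atLeastLessThan_iff le0 restrict_apply')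
      then show ?thesis
        using equivariant_iterate[OF ff(1) rn, of k] equivariant_iterate[OF ff(2) rn, of k] ff(3) rk(2)
        by simp
    next
      case False
      then show ?thesis using ff(1,2) by (auto simp: equivariant_def labelings_def PiE_def extensional_def)
    qed
    then show "f = f'" by blast
  qed
  have "?F ` equivariant n j q = step_residues q (n div gcd n j) \<times> transversals q m (gcd n j)"
  proof
    show "?F ` equivariant n j q \<subseteq> step_residues q (n div gcd n j) \<times> transversals q m (gcd n j)"
      using equivariant_step equivariant_restrict m assms by blast
    show "step_residues q (n div gcd n j) \<times> transversals q m (gcd n j) \<subseteq> ?F ` equivariant n j q"
      using ex_equivariant[OF assms(1) m assms(2)] by blast
  qed
  then have "card (equivariant n j q) = card (step_residues q (n div gcd n j) \<times> transversals q m (gcd n j))"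
    using card_image[OF inj] by simp
  also have "\<dots> = totient (n div gcd n j) * card (transversals q m (gcd n j))"
    unfolding card_cartesian_product card_step_residues[OF assms(2) True] ..
  finally have "int (card (equivariant n j q))
      = int (totient (n div gcd n j)) * int (card (transversals q m (gcd n j)))"
    by (simp only: of_nat_mult)
  moreover have "gcd n j \<ge> 1" using \<open>n > 0\<close> by (simp add: Suc_le_eq)
  ultimately show ?thesis
    using True by (simp only: card_transversals[OF m assms(2)] if_True)
qed

section \<open>Fixed cosets and equivariant labelings\<close>

lemma roots_eq:
  "roots l = {unit_vec i - unit_vec k | i k. i \<in> {1..l+1} \<and> k \<in> {1..l+1} \<and> i \<noteq> k}"
proof -
  have "unit_vec i - unit_vec k \<in> roots l" if "i \<in> {1..l+1}" "k \<in> {1..l+1}" "i \<noteq> k" for i k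
  proof (cases "i < k")
    case True
    then show ?thesis using that unfolding roots_def by auto
  next
    case False
    then have "unit_vec i - unit_vec k = - (unit_vec k - unit_vec i)" "k < i" using that by auto
    then show ?thesis using that unfolding roots_def by auto
  qed
  moreover have "\<exists>i k. \<beta> = unit_vec i - unit_vec k \<and> i \<in> {1..l+1} \<and> k \<in> {1..l+1} \<and> i \<noteq> k"
    if "\<beta> \<in> roots l" for \<beta>
    using that unfolding roots_def
  proof (elim UnE CollectE exE conjE)
    fix i k assume "\<beta> = unit_vec i - unit_vec k" "1 \<le> i" "i < k" "k \<le> l + 1"
    then show ?thesis by (intro exI[of _ i] exI[of _ k]) auto
  next
    fix i k assume "\<beta> = - (unit_vec i - unit_vec k)" "1 \<le> i" "i < k" "k \<le> l + 1"
    then show ?thesis by (intro exI[of _ k] exI[of _ i]) auto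
  qed
  ultimately show ?thesis by blast
qed

lemma ip_root:
  assumes "i \<in> {1..l+1}" "k \<in> {1..l+1}"
  shows "ip l (unit_vec i - unit_vec k) x = x i - x k"
proof -
  have "ip l (unit_vec i - unit_vec k) x =
      (\<Sum>a=1..l+1. (if a = i then x a else 0) - (if a = k then x a else 0))"
    unfolding ip_def by (intro sum.cong) (auto simp: unit_vec_def)
  then show ?thesis using assms by (simp add: sum_subtractf)
qed

lemma coweight_lattice_iff:
  "x \<in> coweight_lattice l \<longleftrightarrow>
     x \<in> euclid l \<and> (\<forall>a\<in>{1..l+1}. \<forall>b\<in>{1..l+1}. x a - x b \<in> \<int>)"
proof -
  have "(\<forall>\<alpha>\<in>roots l. ip l \<alpha> x \<in> \<int>) \<longleftrightarrow> (\<forall>a\<in>{1..l+1}. \<forall>b\<in>{1..l+1}. x a - x b \<in> \<int>)"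
  proof (intro iffI ballI)
    fix a b assume "\<forall>\<alpha>\<in>roots l. ip l \<alpha> x \<in> \<int>" and ab: "a \<in> {1..l+1}" "b \<in> {1..l+1}"
    then have "a \<noteq> b \<longrightarrow> ip l (unit_vec a - unit_vec b) x \<in> \<int>" unfolding roots_eq by blast
    then show "x a - x b \<in> \<int>" unfolding ip_root[OF ab] by (cases "a = b") simp_all
  next
    fix \<alpha> assume "\<forall>a\<in>{1..l+1}. \<forall>b\<in>{1..l+1}. x a - x b \<in> \<int>" "\<alpha> \<in> roots l"
    then obtain a b where "\<alpha> = unit_vec a - unit_vec b" "a \<in> {1..l+1}" "b \<in> {1..l+1}" "x a - x b \<in> \<int>"
      unfolding roots_eq by blast
    then show "ip l \<alpha> x \<in> \<int>" by (simp only: ip_root)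
  qed
  then show ?thesis by (simp add: coweight_lattice_def)
qed

lemma coweight_lattice_comp_perm:
  assumes p: "p permutes {1..l+1}" and x: "x \<in> coweight_lattice l"
  shows "x \<circ> p \<in> coweight_lattice l"
  using x comp_perm_in_euclid[OF p] permutes_in_image[OF p]
  unfolding coweight_lattice_iff by simp

lemma euclid_add_scaled:
  assumes "x \<in> euclid l" "z \<in> euclid l"
  shows "(\<lambda>k. x k + c * z k) \<in> euclid l"
proof -
  have "(\<Sum>k=1..l+1. x k + c * z k) = (\<Sum>k=1..l+1. x k) + c * (\<Sum>k=1..l+1. z k)"
    by (simp only: sum.distrib sum_distrib_left)
  then show ?thesis using assms unfolding euclid_def mem_Collect_eq by (simp del: sum.cl_ivl_Suc)
qed

text \<open>A vector of sum zero whose coordinate differences are all in qZ lies in q times the coweight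
  lattice, because dividing it by q keeps the sum zero.\<close>

lemma lattice_coset_subset:
  assumes x: "x \<in> coweight_lattice l" and y: "y \<in> coweight_lattice l" and "q > 0"
    and eq: "\<And>a b. a \<in> {1..l+1} \<Longrightarrow> b \<in> {1..l+1} \<Longrightarrow> [x a - x b = y a - y b] (rmod real q)"
  shows "lattice_coset l q x \<subseteq> lattice_coset l q y"
proof
  fix v assume "v \<in> lattice_coset l q x"
  then obtain z where z: "z \<in> coweight_lattice l" "v = (\<lambda>k. x k + real q * z k)"
    by (auto simp: lattice_coset_def)
  define u where "u = (\<lambda>k. (x k - y k) / real q + z k)"
  have "u a - u b \<in> \<int>" if ab: "a \<in> {1..l+1}" "b \<in> {1..l+1}" for a b
  proof -
    obtain m where "y a - y b = x a - x b + of_int m * real q"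
      using eq[OF ab] unfolding rcong_altdef by blast
    then have "(x a - y a) / real q - (x b - y b) / real q = of_int (- m)"
      using \<open>q > 0\<close> by (simp add: diff_divide_distrib[symmetric] divide_eq_eq)
    moreover have "z a - z b \<in> \<int>" using z(1) ab unfolding coweight_lattice_iff by blast
    moreover have "u a - u b = ((x a - y a) / real q - (x b - y b) / real q) + (z a - z b)"
      by (simp add: u_def)
    ultimately show ?thesis by (simp only: Ints_add Ints_of_int)
  qed
  moreover have "u \<in> euclid l"
  proof -
    have "x \<in> euclid l" "y \<in> euclid l" "z \<in> euclid l"
      using x y z by (simp_all add: coweight_lattice_iff)
    then have "(\<lambda>k. z k + 1 / real q * (x k + (-1) * y k)) \<in> euclid l"
      by (intro euclid_add_scaled)
    moreover have "(\<lambda>k. z k + 1 / real q * (x k + (-1) * y k)) = u"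
      by (simp add: u_def add.commute)
    ultimately show ?thesis by simp
  qed
  ultimately have "u \<in> coweight_lattice l" unfolding coweight_lattice_iff by blast
  moreover have "v = (\<lambda>k. y k + real q * u k)"
    using \<open>q > 0\<close> by (simp add: z u_def distrib_left)
  ultimately show "v \<in> lattice_coset l q y" unfolding lattice_coset_def by blast
qed

lemma lattice_coset_eq_iff:
  assumes x: "x \<in> coweight_lattice l" and y: "y \<in> coweight_lattice l" and "q > 0"
  shows "lattice_coset l q x = lattice_coset l q y \<longleftrightarrow>
    (\<forall>a\<in>{1..l+1}. \<forall>b\<in>{1..l+1}. [x a - x b = y a - y b] (rmod real q))"
proof (intro iffI ballI)
  fix a b assume eq: "lattice_coset l q x = lattice_coset l q y" and ab: "a \<in> {1..l+1}" "b \<in> {1..l+1}"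
  have "(\<lambda>k. 0) \<in> coweight_lattice l" by (simp add: coweight_lattice_iff euclid_def)
  then have "(\<lambda>k. x k + real q * 0) \<in> lattice_coset l q x" unfolding lattice_coset_def by fastforce
  then obtain z where z: "z \<in> coweight_lattice l" "x = (\<lambda>k. y k + real q * z k)"
    unfolding eq by (auto simp: lattice_coset_def)
  then obtain m where m: "z a - z b = of_int m"
    using ab unfolding coweight_lattice_iff by (blast elim: Ints_cases)
  have "x a - x b = y a - y b + real q * (z a - z b)" by (simp add: z(2) algebra_simps)
  then have "x a - x b = y a - y b + of_int m * real q" unfolding m by simp
  then have "[y a - y b = x a - x b] (rmod real q)" unfolding rcong_altdef by blast
  then show "[x a - x b = y a - y b] (rmod real q)" by (rule rcong_sym)
next
  assume eq: "\<forall>a\<in>{1..l+1}. \<forall>b\<in>{1..l+1}. [x a - x b = y a - y b] (rmod real q)"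
  then show "lattice_coset l q x = lattice_coset l q y"
    using lattice_coset_subset[OF x y \<open>q > 0\<close>] lattice_coset_subset[OF y x \<open>q > 0\<close>]
    by (intro equalityI) (blast intro: rcong_sym)+
qed

lemma perm_action_lattice_coset:
  assumes p: "p permutes {1..l+1}" and x: "x \<in> coweight_lattice l"
  shows "perm_action l p ` lattice_coset l q x = lattice_coset l q (x \<circ> p)"
proof -
  define r where "r = inv_into UNIV p"
  have r: "r permutes {1..l+1}" "r \<circ> p = id"
    using permutes_inv[OF p] permutes_inv_o[OF p] by (simp_all add: r_def)
  have act: "perm_action l p (\<lambda>k. x k + real q * z k) = (\<lambda>k. (x \<circ> p) k + real q * (z \<circ> p) k)"
    if "z \<in> coweight_lattice l" for z
  proof -
    have "(\<lambda>k. x k + real q * z k) \<in> euclid l"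
      using x that unfolding coweight_lattice_iff by (intro euclid_add_scaled) simp_all
    then show ?thesis by (simp add: perm_action_def comp_def)
  qed
  show ?thesis
  proof
    show "perm_action l p ` lattice_coset l q x \<subseteq> lattice_coset l q (x \<circ> p)"
      unfolding lattice_coset_def using act coweight_lattice_comp_perm[OF p] by blast
    show "lattice_coset l q (x \<circ> p) \<subseteq> perm_action l p ` lattice_coset l q x"
    proof
      fix v assume "v \<in> lattice_coset l q (x \<circ> p)"
      then obtain z where z: "z \<in> coweight_lattice l" "v = (\<lambda>k. (x \<circ> p) k + real q * z k)"
        unfolding lattice_coset_def by blast
      have zr: "z \<circ> r \<in> coweight_lattice l" using coweight_lattice_comp_perm[OF r(1) z(1)] .
      have "z = (z \<circ> r) \<circ> p" by (simp only: comp_assoc r(2) comp_id)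
      then have "v = perm_action l p (\<lambda>k. x k + real q * (z \<circ> r) k)"
        unfolding act[OF zr] z(2) by simp
      then show "v \<in> perm_action l p ` lattice_coset l q x"
        unfolding lattice_coset_def using zr by blast
    qed
  qed
qed

lemma rcong_of_nat_iff: "[real a = real b] (rmod real q) \<longleftrightarrow> [a = b] (mod q)"
proof -
  have "[real a = real b] (rmod real q) \<longleftrightarrow> (\<exists>m. real_of_int (int b) = real_of_int (int a + m * int q))"
    unfolding rcong_altdef by simp
  also have "\<dots> \<longleftrightarrow> (\<exists>m. int b = int a + m * int q)" unfolding of_int_eq_iff ..
  also have "\<dots> \<longleftrightarrow> [int a = int b] (mod int q)"
    by (auto simp: cong_iff_lin mult.commute)
  finally show ?thesis by (simp add: cong_int_iff)
qed

text \<open>Integer coordinates have an arbitrary sum; subtracting their mean gives a vector of the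
  coweight lattice with the same differences. The labels are indexed from 0, the coordinates from 1.\<close>

definition centered :: "nat \<Rightarrow> (nat \<Rightarrow> nat) \<Rightarrow> nat \<Rightarrow> real" where
  "centered l f k =
     (if k \<in> {1..l+1} then real (f (k - 1)) - (\<Sum>i=1..l+1. real (f (i - 1))) / real (l + 1) else 0)"

lemma centered_diff:
  "a \<in> {1..l+1} \<Longrightarrow> b \<in> {1..l+1} \<Longrightarrow> centered l f a - centered l f b = real (f (a - 1)) - real (f (b - 1))"
  by (simp add: centered_def)

lemma centered_in_lattice: "centered l f \<in> coweight_lattice l"
proof -
  have "(\<Sum>k=1..l+1. centered l f k)
      = (\<Sum>k=1..l+1. real (f (k - 1)) - (\<Sum>i=1..l+1. real (f (i - 1))) / real (l + 1))"
    by (intro sum.cong refl) (simp only: centered_def if_True)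
  also have "\<dots> = 0" by (simp only: sum_subtractf sum_constant card_atLeastAtMost) simp
  finally have "centered l f \<in> euclid l" by (simp add: euclid_def centered_def)
  moreover have "centered l f a - centered l f b \<in> \<int>" if "a \<in> {1..l+1}" "b \<in> {1..l+1}" for a b
    unfolding centered_diff[OF that] by (intro Ints_diff Ints_of_nat)
  ultimately show ?thesis unfolding coweight_lattice_iff by blast
qed

text \<open>All differences agree modulo q as soon as those with the first coordinate do.\<close>

lemma coset_centered_eq_iff:
  assumes y: "y \<in> coweight_lattice l" and "q > 0" and f0: "f 0 = 0"
  shows "lattice_coset l q (centered l f) = lattice_coset l q y \<longleftrightarrow>
    (\<forall>i<l+1. [real (f i) = y (i + 1) - y 1] (rmod real q))"
  unfolding lattice_coset_eq_iff[OF centered_in_lattice y \<open>q > 0\<close>]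
proof (intro iffI ballI allI impI)
  fix i assume eq: "\<forall>a\<in>{1..l+1}. \<forall>b\<in>{1..l+1}.
      [centered l f a - centered l f b = y a - y b] (rmod real q)" and i: "i < l + 1"
  have ab: "i + 1 \<in> {1..l+1}" "1 \<in> {1..l+1}" using i by simp_all
  have "[centered l f (i + 1) - centered l f 1 = y (i + 1) - y 1] (rmod real q)"
    using eq ab by blast
  then show "[real (f i) = y (i + 1) - y 1] (rmod real q)"
    unfolding centered_diff[OF ab] by (simp add: f0)
next
  fix a b assume eq: "\<forall>i<l+1. [real (f i) = y (i + 1) - y 1] (rmod real q)"
    and ab: "a \<in> {1..l+1}" "b \<in> {1..l+1}"
  have one: "[real (f (a - 1)) = y a - y 1] (rmod real q)" if "a \<in> {1..l+1}" for a
  proof -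
    have "a - 1 < l + 1" "a - 1 + 1 = a" using that by auto
    then show ?thesis using eq by metis
  qed
  have "[real (f (a - 1)) - real (f (b - 1)) = (y a - y 1) - (y b - y 1)] (rmod real q)"
    by (intro rcong_diff one ab)
  then show "[centered l f a - centered l f b = y a - y b] (rmod real q)"
    unfolding centered_diff[OF ab] by simp
qed

text \<open>The roots are the differences e_i - e_k, so the condition that no root vanishes modulo q is the
  injectivity of the labeling.\<close>

lemma bij_betw_labelings_complement:
  assumes "q > 0"
  shows "bij_betw (\<lambda>f. lattice_coset l q (centered l f)) (labelings (l+1) q) (complement_mod l q)"
  unfolding bij_betw_def
proof
  let ?T = "\<lambda>f. lattice_coset l q (centered l f)"
  show "inj_on ?T (labelings (l+1) q)"
  proof (rule inj_onI)
    fix f f' assume f: "f \<in> labelings (l+1) q" "f' \<in> labelings (l+1) q" and eq: "?T f = ?T f'"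
    have f0: "f 0 = 0" "f' 0 = 0" using f by (simp_all add: labelings_def)
    have "f i = f' i" if i: "i < l + 1" for i
    proof -
      have "[real (f i) = centered l f' (i + 1) - centered l f' 1] (rmod real q)"
        using eq i coset_centered_eq_iff[OF centered_in_lattice \<open>q > 0\<close>, of f l f'] f0 by blast
      also have "centered l f' (i + 1) - centered l f' 1 = real (f' i)"
        using i f0 by (subst centered_diff) simp_all
      finally have "[f i = f' i] (mod q)" unfolding rcong_of_nat_iff .
      moreover have "f i < q" "f' i < q" using f i by (auto simp: labelings_def)
      ultimately show ?thesis by (simp add: cong_less_modulus_unique_nat)
    qed
    then show "f = f'" using f unfolding labelings_def
      by (intro PiE_ext[of f "{0..<l+1}" "\<lambda>_. {0..<q}" f']) simp_all
  qed
  show "?T ` labelings (l+1) q = complement_mod l q"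
  proof
    show "?T ` labelings (l+1) q \<subseteq> complement_mod l q"
    proof clarify
      fix f assume f: "f \<in> labelings (l+1) q"
      have "\<not> [ip l \<beta> (centered l f) = 0] (rmod real q)" if \<beta>: "\<beta> \<in> roots l" for \<beta>
      proof
        assume 0: "[ip l \<beta> (centered l f) = 0] (rmod real q)"
        obtain i k where ik: "\<beta> = unit_vec i - unit_vec k" "i \<in> {1..l+1}" "k \<in> {1..l+1}" "i \<noteq> k"
          using \<beta> unfolding roots_eq by blast
        have "[real (f (i - 1)) - real (f (k - 1)) + real (f (k - 1)) = 0 + real (f (k - 1))] (rmod real q)"
          using 0 unfolding ik(1) ip_root[OF ik(2,3)] centered_diff[OF ik(2,3)] by (intro rcong_add) simp_all
        then have "[f (i - 1) = f (k - 1)] (mod q)" by (simp add: rcong_of_nat_iff)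
        moreover have less: "i - 1 \<in> {0..<l+1}" "k - 1 \<in> {0..<l+1}" using ik by auto
        then have "f (i - 1) < q" "f (k - 1) < q"
          using f unfolding labelings_def by (auto simp del: One_nat_def)
        ultimately have "f (i - 1) = f (k - 1)" by (simp add: cong_less_modulus_unique_nat)
        then have "i - 1 = k - 1" using f less unfolding labelings_def by (blast dest: inj_onD)
        then show False using ik by auto
      qed
      then show "?T f \<in> complement_mod l q"
        unfolding complement_mod_def using centered_in_lattice by blast
    qed
    show "complement_mod l q \<subseteq> ?T ` labelings (l+1) q"
    proof
      fix t assume "t \<in> complement_mod l q"
      then obtain x where x: "x \<in> coweight_lattice l" "t = lattice_coset l q x"
        and ne: "\<And>\<beta>. \<beta> \<in> roots l \<Longrightarrow> \<not> [ip l \<beta> x = 0] (rmod real q)"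
        unfolding complement_mod_def by blast
      define f where "f = (\<lambda>i\<in>{0..<l+1}. nat (\<lfloor>x (i + 1) - x 1\<rfloor> mod int q))"
      have val: "[real (f i) = x (i + 1) - x 1] (rmod real q)" if i: "i < l + 1" for i
      proof -
        have "x (i + 1) - x 1 \<in> \<int>" using x(1) i unfolding coweight_lattice_iff by simp
        then obtain m where m: "x (i + 1) - x 1 = of_int m" by (rule Ints_cases)
        have "int (f i) = m mod int q" using i m \<open>q > 0\<close> by (simp add: f_def)
        then have "m = int (f i) + m div int q * int q" by simp
        then have "real_of_int m = real (f i) + of_int (m div int q) * real q"
          by (metis of_int_add of_int_mult of_int_of_nat_eq)
        then show ?thesis unfolding m rcong_altdef by blast
      qed
      have f0: "f 0 = 0" by (simp add: f_def)
      have "f \<in> {0..<l+1} \<rightarrow>\<^sub>E {0..<q}"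
        using \<open>q > 0\<close> by (auto simp: f_def nat_less_iff)
      moreover have "inj_on f {0..<l+1}"
      proof (rule inj_onI, rule ccontr)
        fix i k assume ik: "i \<in> {0..<l+1}" "k \<in> {0..<l+1}" "f i = f k" "i \<noteq> k"
        have "[x (i + 1) - x 1 - (x (k + 1) - x 1) = real (f i) - real (f k)] (rmod real q)"
          using val[of i] val[of k] ik by (intro rcong_diff) (auto intro: rcong_sym)
        then have "[x (i + 1) - x (k + 1) = 0] (rmod real q)" using ik(3) by simp
        moreover have mem: "i + 1 \<in> {1..l+1}" "k + 1 \<in> {1..l+1}" using ik by auto
        moreover have "unit_vec (i + 1) - unit_vec (k + 1) \<in> roots l"
          unfolding roots_eq using mem ik(4) by auto
        ultimately show False using ne ip_root[OF mem, of x] by metis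
      qed
      ultimately have "f \<in> labelings (l+1) q" using f0 by (simp add: labelings_def)
      moreover have "?T f = t"
        unfolding x(2) using coset_centered_eq_iff[where f = f, OF x(1) \<open>q > 0\<close> f0] val by blast
      ultimately show "t \<in> ?T ` labelings (l+1) q" by blast
    qed
  qed
qed

text \<open>By \<open>coset_centered_eq_iff\<close> only the differences with the first coordinate matter. After the shift
  the first coordinate carries the label of the position s mod n, which is therefore the constant
  added to the labeling.\<close>

lemma fixed_coset_iff_equivariant:
  assumes f: "f \<in> labelings (l+1) q" and "q > 0"
  shows "perm_action l (cyclic_shift (l+1) s) ` lattice_coset l q (centered l f) = lattice_coset l q (centered l f)
     \<longleftrightarrow> f \<in> equivariant (l+1) s q"
proof -
  let ?x = "centered l f \<circ> cyclic_shift (l+1) s"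
  have f0: "f 0 = 0" using f by (simp add: labelings_def)
  have x: "?x \<in> coweight_lattice l"
    by (intro coweight_lattice_comp_perm cyclic_shift_permutes centered_in_lattice)
  have diff: "?x (i + 1) - ?x 1 = real (f ((i + s) mod (l+1))) - real (f (s mod (l+1)))"
    if "i < l + 1" for i
  proof -
    have "cyclic_shift (l+1) s (i + 1) = (i + s) mod (l+1) + 1" "cyclic_shift (l+1) s 1 = s mod (l+1) + 1"
      using that by (simp_all add: cyclic_shift_def)
    moreover have "k mod (l+1) + 1 \<in> {1..l+1}" for k by (simp add: Suc_le_eq)
    ultimately show ?thesis by (simp only: comp_apply centered_diff diff_add_inverse2)
  qed
  have "perm_action l (cyclic_shift (l+1) s) ` lattice_coset l q (centered l f) = lattice_coset l q (centered l f)
      \<longleftrightarrow> lattice_coset l q (centered l f) = lattice_coset l q ?x"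
    unfolding perm_action_lattice_coset[OF cyclic_shift_permutes centered_in_lattice] by (rule eq_commute)
  also have "\<dots> \<longleftrightarrow> (\<forall>i<l+1. [real (f i) = ?x (i + 1) - ?x 1] (rmod real q))"
    by (rule coset_centered_eq_iff[where f = f, OF x \<open>q > 0\<close> f0])
  also have "\<dots> \<longleftrightarrow> (\<forall>i<l+1. f ((i + s) mod (l+1)) = (f i + f (s mod (l+1))) mod q)"
  proof (intro all_cong)
    fix i assume i: "i < l + 1"
    have less: "f ((i + s) mod (l+1)) < q" using f by (auto simp: labelings_def)
    have "[real (f i) = ?x (i + 1) - ?x 1] (rmod real q) \<longleftrightarrow>
        [real (f i) + real (f (s mod (l+1))) = real (f ((i + s) mod (l+1))) - real (f (s mod (l+1))) + real (f (s mod (l+1)))] (rmod real q)"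
      unfolding diff[OF i] rcong_add_right_cancel ..
    also have "\<dots> \<longleftrightarrow> [f i + f (s mod (l+1)) = f ((i + s) mod (l+1))] (mod q)"
      unfolding rcong_of_nat_iff[symmetric] by simp
    also have "\<dots> \<longleftrightarrow> f ((i + s) mod (l+1)) = (f i + f (s mod (l+1))) mod q"
      using less by (auto simp: cong_def)
    finally show "[real (f i) = ?x (i + 1) - ?x 1] (rmod real q) \<longleftrightarrow>
        f ((i + s) mod (l+1)) = (f i + f (s mod (l+1))) mod q" .
  qed
  also have "\<dots> \<longleftrightarrow> f \<in> equivariant (l+1) s q"
    using f unfolding equivariant_def by blast
  finally show ?thesis .
qed

lemma chi_cyclic_shift:
  assumes "q > 0"
  shows "chi l q (perm_action l (cyclic_shift (l+1) s)) = card (equivariant (l+1) s q)"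
proof -
  let ?T = "\<lambda>f. lattice_coset l q (centered l f)" and ?w = "perm_action l (cyclic_shift (l+1) s)"
  note bij = bij_betw_labelings_complement[OF assms, of l]
  have sub: "equivariant (l+1) s q \<subseteq> labelings (l+1) q"
    unfolding equivariant_def by blast
  have "{t \<in> complement_mod l q. ?w ` t = t} = ?T ` equivariant (l+1) s q"
    unfolding bij_betw_imp_surj_on[OF bij, symmetric]
    using fixed_coset_iff_equivariant[OF _ assms] sub by blast
  moreover have "inj_on ?T (equivariant (l+1) s q)"
    using bij_betw_imp_inj_on[OF bij] sub by (rule inj_on_subset)
  ultimately show ?thesis unfolding chi_def by (simp only: card_image)
qed

section \<open>The number of fixed points\<close>

theorem theorem5p2:
  fixes l j q g d :: nat
    and \<omega> :: "(nat \<Rightarrow> real) \<Rightarrow> (nat \<Rightarrow> real)"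
  assumes "l \<ge> 1"
    and "j \<in> {0..l}"
    and "\<omega> = omega l j"
    and "g = gcd (l+1) j"
    and "d = group.ord (weyl_group l) \<omega>"
    and "q > 0"
  shows "int (chi l q \<omega>) =
           (if d dvd q
            then int (totient d) * (\<Prod>k\<in>{1..<g}. int q - int d * int k)
            else 0)"
proof -
  have \<omega>: "\<omega> = perm_action l (cyclic_shift (l+1) (l + 1 - j))"
    using assms omega_eq[of j l] by simp
  have g: "gcd (l+1) (l + 1 - j) = g"
    using assms gcd_diff2_nat[of j "l+1"] by (simp add: gcd.commute)
  have "d = (l+1) div g"
    unfolding assms(5) \<omega> ord_cyclic_shift g ..
  then show ?thesis
    using card_equivariant[of "l+1" q "l + 1 - j"] assms(6)
    unfolding \<omega> chi_cyclic_shift[OF assms(6)] g by simp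
qed

end
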